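(* Let $\mathcal C=\mathcal C_{\mathrm{sup}}\sqcup\mathcal C_{\mathrm{free}}\sqcup\mathcal C_{\mathrm{inf}}$, $c_\infty\notin\mathcal C$, $\epsilon$, $\delta$, $\gamma$ be as in the context, and let $c_0\in\mathcal C_{\mathrm{free}}$ satisfy $\epsilon(c_0,c)=\epsilon(c,c_0)=1$ for all $c\in\mathcal C\setminus\{c_0\}$. Then there is a bijection $\Phi$ from $\mathcal P^{c_\infty}_\epsilon$ to ${}^{c_0}_{\delta,\gamma}\mathcal P^{c_\infty}_\epsilon\times\mathcal P$, where $\mathcal P$ is the set of ordinary integer partitions, such that if $\Phi(\lambda)=(\mu,\nu)$ then $|\lambda|=|\mu|+|\nu|$, $\ell(\lambda)=\ell(\mu)+\ell(\nu)$, and the product of the colours of the parts of $\lambda$ with colours in $\mathcal C_{\mathrm{sup}}\sqcup\mathcal C_{\mathrm{inf}}$ equals the corresponding product for $\mu$.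
   Context: Colours are formal symbols; a coloured integer $k_c$ has size $k\in\mathbb Z$ and colour $c$. $\chi(P)\in\{0,1\}$ is the truth value. $\mathcal C$ is a set of colours partitioned as $\mathcal C_{\mathrm{sup}}\sqcup\mathcal C_{\mathrm{free}}\sqcup\mathcal C_{\mathrm{inf}}$, and $\epsilon:\mathcal C\times(\mathcal C\sqcup\{c_\infty\})\to\{0,1,2\}$ is well-defined, i.e.: (1) $\epsilon(c,c')=\chi(c\ne c')$ for $c,c'\in\mathcal C_{\mathrm{free}}$; (2) for $(c,c')\in\mathcal C_{\mathrm{sup}}\times\mathcal C_{\mathrm{free}}$, $\epsilon(c,c')\in\{0,1\}$, $\epsilon(c',c)\in\{1,2\}$, and each $c\in\mathcal C_{\mathrm{sup}}$ has some $f\in\mathcal C_{\mathrm{free}}$ with $\epsilon(c,f)=0$; (3) for $(c,c')\in\mathcal C_{\mathrm{free}}\times\mathcal C_{\mathrm{inf}}$, $\epsilon(c,c')\in\{0,1\}$, $\epsilon(c',c)\in\{1,2\}$, and each $c\in\mathcal C_{\mathrm{inf}}$ has some $f\in\mathcal C_{\mathrm{free}}$ with $\epsilon(f,c)=0$; (4) for $(c,c')\in\mathcal C_{\mathrm{sup}}\times\mathcal C_{\mathrm{inf}}$, $\epsilon(c,c')\in\{0,1\}$, $\epsilon(c',c)\in\{1,2\}$, and if $\epsilon(c,c')=0$ there is $f\in\mathcal C_{\mathrm{free}}$ with $\epsilon(c,f)=\epsilon(f,c')=0$; (5) for $c,c'\in\mathcal C_{\mathrm{sup}}$ with $\epsilon(c,c')\in\{0,1\}$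 there is $f\in\mathcal C_{\mathrm{free}}$ with $\epsilon(c,f)=0$, $\epsilon(f,c')=1$; (6) for $c,c'\in\mathcal C_{\mathrm{inf}}$ with $\epsilon(c,c')\in\{0,1\}$ there is $f\in\mathcal C_{\mathrm{free}}$ with $\epsilon(c,f)=1$, $\epsilon(f,c')=0$; (7) $\epsilon(f,c_\infty)=1$ for $f\in\mathcal C_{\mathrm{free}}$, $\epsilon(c,c_\infty)\in\{1,2\}$ for $c\in\mathcal C_{\mathrm{inf}}$, $\epsilon(c,c_\infty)\in\{0,1\}$ for $c\in\mathcal C_{\mathrm{sup}}$. Fix $\delta(c)\in\mathcal C_{\mathrm{free}}$ for each $c\in\mathcal C_{\mathrm{sup}}\sqcup\mathcal C_{\mathrm{inf}}$ witnessing (2) resp. (3) (i.e. $\epsilon(c,\delta(c))=0$ resp. $\epsilon(\delta(c),c)=0$), and $\gamma(c,c')\in\mathcal C_{\mathrm{free}}$ witnessing (4), (5), (6) for each pair there. Write $k_c\gg_\epsilon k'_{c'}$ iff $k-k'\ge\epsilon(c,c')$. $\mathcal P^{c_\infty}_\epsilon$ is the set of sequences $(\pi_0,\dots,\pi_{s-1},\pi_s=0_{c_\infty})$ with $c(\pi_j)\in\mathcal C$ and $\pi_j\gg_\epsilon\pi_{j+1}$ for $j<s$. A sequence contains a pattern $\lambda_0,\dots,\lambda_k$ if $\lambda_0,\dots,\lambda_k$ occur as consecutive parts. ${}^{c_0}_{\delta,\gamma}\mathcal P^{c_\infty}_\epsilon$ is the set of elements of $\mathcal P^{c_\infty}_\epsilon$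 with no part of colour $c_0$ that contain none of the following patterns, for all integers $p\ge0$: (1) $p_c,p_c$ for $c\in\mathcal C_{\mathrm{free}}\setminus\{c_0\}$; (2) $p_c,p_{\gamma(c,c')},p_{c'}$ for $(c,c')\in\mathcal C_{\mathrm{sup}}\times\mathcal C_{\mathrm{inf}}$ with $\epsilon(c,c')=0$; (3) $p_c,p_{\gamma(c,c')},(p-1)_{c'}$ for $c,c'\in\mathcal C_{\mathrm{sup}}$ with $\epsilon(c,c')\in\{0,1\}$; (4) $(p+1)_c,p_{\gamma(c,c')},p_{c'}$ for $c,c'\in\mathcal C_{\mathrm{inf}}$ with $\epsilon(c,c')\in\{0,1\}$; (5) for $c\in\mathcal C_{\mathrm{sup}}$: (a) $p_c,p_{\delta(c)},(p-1)_{c'}$ for $c'\in(\mathcal C_{\mathrm{free}}\setminus\{c_0\})\sqcup\mathcal C_{\mathrm{inf}}\sqcup\{c_\infty\}$, (b) $p_c,p_{\delta(c)},(p-u)_{c'}$ for $c'\in(\mathcal C\setminus\{c_0\})\sqcup\{c_\infty\}$ and integers $u\ge2$; (6) for $c'\in\mathcal C_{\mathrm{inf}}$: (a) $p_{\delta(c')},p_{c'}$ as the first two parts of the sequence, (b) $(p+1)_c,p_{\delta(c')},p_{c'}$ for $c\in(\mathcal C_{\mathrm{free}}\setminus\{c_0\})\sqcup\mathcal C_{\mathrm{sup}}$, (c) $(p+u)_c,p_{\delta(c')},p_{c'}$ for $c\in\mathcal C\setminus\{c_0\}$ and integers $u\ge2$. For sequences, $|\cdot|$ is the sum of sizes and $\ell(\cdot)$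 the number of parts. *)

theory Defs
  imports Complex_Main "HOL-Library.Multiset" "HOL-Library.Sublist"
begin

text \<open>
  A coloured integer of size \<open>k\<close> and colour \<open>c\<close> is the pair \<open>(k, c)\<close>. The extra colour
  \<open>cinfty\<close> lives in the same type as the other colours and is kept outside
  \<open>Csup \<union> Cfree \<union> Cinf\<close>; values \<open>\<epsilon> c c'\<close> outside
  \<open>(Csup \<union> Cfree \<union> Cinf) \<times> (Csup \<union> Cfree \<union> Cinf \<union> {cinfty})\<close> are never constrained or used.
\<close>

type_synonym 'c coloured_int = "int \<times> 'c"

definition colour_partition :: "'c set \<Rightarrow> 'c set \<Rightarrow> 'c set \<Rightarrow> 'c \<Rightarrow> bool" where
  "colour_partition Csup Cfree Cinf cinfty \<longleftrightarrow>
     Csup \<inter> Cfree = {} \<and> Csup \<inter> Cinf = {} \<and> Cfree \<inter> Cinf = {} \<and>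
     cinfty \<notin> Csup \<union> Cfree \<union> Cinf"

definition well_defined_eps ::
    "'c set \<Rightarrow> 'c set \<Rightarrow> 'c set \<Rightarrow> 'c \<Rightarrow> ('c \<Rightarrow> 'c \<Rightarrow> nat) \<Rightarrow> bool" where
  "well_defined_eps Csup Cfree Cinf cinfty \<epsilon> \<longleftrightarrow>
     (\<forall>c\<in>Csup \<union> Cfree \<union> Cinf. \<forall>c'\<in>Csup \<union> Cfree \<union> Cinf \<union> {cinfty}. \<epsilon> c c' \<in> {0, 1, 2}) \<and>
     (\<forall>c\<in>Cfree. \<forall>c'\<in>Cfree. \<epsilon> c c' = (if c \<noteq> c' then 1 else 0)) \<and>
     (\<forall>c\<in>Csup. \<forall>c'\<in>Cfree. \<epsilon> c c' \<in> {0, 1} \<and> \<epsilon> c' c \<in> {1, 2}) \<and>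
     (\<forall>c\<in>Csup. \<exists>f\<in>Cfree. \<epsilon> c f = 0) \<and>
     (\<forall>c\<in>Cfree. \<forall>c'\<in>Cinf. \<epsilon> c c' \<in> {0, 1} \<and> \<epsilon> c' c \<in> {1, 2}) \<and>
     (\<forall>c\<in>Cinf. \<exists>f\<in>Cfree. \<epsilon> f c = 0) \<and>
     (\<forall>c\<in>Csup. \<forall>c'\<in>Cinf. \<epsilon> c c' \<in> {0, 1} \<and> \<epsilon> c' c \<in> {1, 2} \<and>
        (\<epsilon> c c' = 0 \<longrightarrow> (\<exists>f\<in>Cfree. \<epsilon> c f = 0 \<and> \<epsilon> f c' = 0))) \<and>
     (\<forall>c\<in>Csup. \<forall>c'\<in>Csup. \<epsilon> c c' \<in> {0, 1} \<longrightarrow> (\<exists>f\<in>Cfree. \<epsilon> c f = 0 \<and> \<epsilon> f c' = 1)) \<and>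
     (\<forall>c\<in>Cinf. \<forall>c'\<in>Cinf. \<epsilon> c c' \<in> {0, 1} \<longrightarrow> (\<exists>f\<in>Cfree. \<epsilon> c f = 1 \<and> \<epsilon> f c' = 0)) \<and>
     (\<forall>f\<in>Cfree. \<epsilon> f cinfty = 1) \<and>
     (\<forall>c\<in>Cinf. \<epsilon> c cinfty \<in> {1, 2}) \<and>
     (\<forall>c\<in>Csup. \<epsilon> c cinfty \<in> {0, 1})"

definition delta_witness ::
    "'c set \<Rightarrow> 'c set \<Rightarrow> 'c set \<Rightarrow> ('c \<Rightarrow> 'c \<Rightarrow> nat) \<Rightarrow> ('c \<Rightarrow> 'c) \<Rightarrow> bool" where
  "delta_witness Csup Cfree Cinf \<epsilon> \<delta> \<longleftrightarrow>
     (\<forall>c\<in>Csup. \<delta> c \<in> Cfree \<and> \<epsilon> c (\<delta> c) = 0) \<and>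
     (\<forall>c\<in>Cinf. \<delta> c \<in> Cfree \<and> \<epsilon> (\<delta> c) c = 0)"

definition gamma_witness ::
    "'c set \<Rightarrow> 'c set \<Rightarrow> 'c set \<Rightarrow> ('c \<Rightarrow> 'c \<Rightarrow> nat) \<Rightarrow> ('c \<Rightarrow> 'c \<Rightarrow> 'c) \<Rightarrow> bool" where
  "gamma_witness Csup Cfree Cinf \<epsilon> \<gamma> \<longleftrightarrow>
     (\<forall>c\<in>Csup. \<forall>c'\<in>Cinf. \<epsilon> c c' = 0 \<longrightarrow>
        \<gamma> c c' \<in> Cfree \<and> \<epsilon> c (\<gamma> c c') = 0 \<and> \<epsilon> (\<gamma> c c') c' = 0) \<and>
     (\<forall>c\<in>Csup. \<forall>c'\<in>Csup. \<epsilon> c c' \<in> {0, 1} \<longrightarrow>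
        \<gamma> c c' \<in> Cfree \<and> \<epsilon> c (\<gamma> c c') = 0 \<and> \<epsilon> (\<gamma> c c') c' = 1) \<and>
     (\<forall>c\<in>Cinf. \<forall>c'\<in>Cinf. \<epsilon> c c' \<in> {0, 1} \<longrightarrow>
        \<gamma> c c' \<in> Cfree \<and> \<epsilon> c (\<gamma> c c') = 1 \<and> \<epsilon> (\<gamma> c c') c' = 0)"

definition gg :: "('c \<Rightarrow> 'c \<Rightarrow> nat) \<Rightarrow> 'c coloured_int \<Rightarrow> 'c coloured_int \<Rightarrow> bool" where
  "gg \<epsilon> x y \<longleftrightarrow> fst x - fst y \<ge> int (\<epsilon> (snd x) (snd y))"

definition grounded_partitions ::
    "'c set \<Rightarrow> 'c \<Rightarrow> ('c \<Rightarrow> 'c \<Rightarrow> nat) \<Rightarrow> 'c coloured_int list set" where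
  "grounded_partitions C cinfty \<epsilon> =
     {xs @ [(0, cinfty)] | xs.
        (\<forall>x\<in>set xs. snd x \<in> C) \<and> successively (gg \<epsilon>) (xs @ [(0, cinfty)])}"

inductive_set forbidden_patterns :: "'c set \<Rightarrow> 'c set \<Rightarrow> 'c set \<Rightarrow> 'c \<Rightarrow> 'c \<Rightarrow>
    ('c \<Rightarrow> 'c \<Rightarrow> nat) \<Rightarrow> ('c \<Rightarrow> 'c) \<Rightarrow> ('c \<Rightarrow> 'c \<Rightarrow> 'c) \<Rightarrow> 'c coloured_int list set"
  for Csup Cfree Cinf :: "'c set" and cinfty c0 :: 'c and \<epsilon> :: "'c \<Rightarrow> 'c \<Rightarrow> nat"
    and \<delta> :: "'c \<Rightarrow> 'c" and \<gamma> :: "'c \<Rightarrow> 'c \<Rightarrow> 'c" where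
  free_repeat: "\<lbrakk>p \<ge> 0; c \<in> Cfree - {c0}\<rbrakk>
     \<Longrightarrow> [(p, c), (p, c)] \<in> forbidden_patterns Csup Cfree Cinf cinfty c0 \<epsilon> \<delta> \<gamma>"
| gamma_sup_inf: "\<lbrakk>p \<ge> 0; c \<in> Csup; c' \<in> Cinf; \<epsilon> c c' = 0\<rbrakk>
     \<Longrightarrow> [(p, c), (p, \<gamma> c c'), (p, c')] \<in> forbidden_patterns Csup Cfree Cinf cinfty c0 \<epsilon> \<delta> \<gamma>"
| gamma_sup_sup: "\<lbrakk>p \<ge> 0; c \<in> Csup; c' \<in> Csup; \<epsilon> c c' \<in> {0, 1}\<rbrakk>
     \<Longrightarrow> [(p, c), (p, \<gamma> c c'), (p - 1, c')] \<in> forbidden_patterns Csup Cfree Cinf cinfty c0 \<epsilon> \<delta> \<gamma>"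
| gamma_inf_inf: "\<lbrakk>p \<ge> 0; c \<in> Cinf; c' \<in> Cinf; \<epsilon> c c' \<in> {0, 1}\<rbrakk>
     \<Longrightarrow> [(p + 1, c), (p, \<gamma> c c'), (p, c')] \<in> forbidden_patterns Csup Cfree Cinf cinfty c0 \<epsilon> \<delta> \<gamma>"
| delta_sup_1: "\<lbrakk>p \<ge> 0; c \<in> Csup; c' \<in> (Cfree - {c0}) \<union> Cinf \<union> {cinfty}\<rbrakk>
     \<Longrightarrow> [(p, c), (p, \<delta> c), (p - 1, c')] \<in> forbidden_patterns Csup Cfree Cinf cinfty c0 \<epsilon> \<delta> \<gamma>"
| delta_sup_2: "\<lbrakk>p \<ge> 0; c \<in> Csup; c' \<in> ((Csup \<union> Cfree \<union> Cinf) - {c0}) \<union> {cinfty}; u \<ge> 2\<rbrakk>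
     \<Longrightarrow> [(p, c), (p, \<delta> c), (p - u, c')] \<in> forbidden_patterns Csup Cfree Cinf cinfty c0 \<epsilon> \<delta> \<gamma>"
| delta_inf_1: "\<lbrakk>p \<ge> 0; c' \<in> Cinf; c \<in> (Cfree - {c0}) \<union> Csup\<rbrakk>
     \<Longrightarrow> [(p + 1, c), (p, \<delta> c'), (p, c')] \<in> forbidden_patterns Csup Cfree Cinf cinfty c0 \<epsilon> \<delta> \<gamma>"
| delta_inf_2: "\<lbrakk>p \<ge> 0; c' \<in> Cinf; c \<in> (Csup \<union> Cfree \<union> Cinf) - {c0}; u \<ge> 2\<rbrakk>
     \<Longrightarrow> [(p + u, c), (p, \<delta> c'), (p, c')] \<in> forbidden_patterns Csup Cfree Cinf cinfty c0 \<epsilon> \<delta> \<gamma>"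

text \<open>
  Patterns may use the final part \<open>(0, cinfty)\<close>, so they are sought in the whole sequence.
\<close>

definition restricted_partitions :: "'c set \<Rightarrow> 'c set \<Rightarrow> 'c set \<Rightarrow> 'c \<Rightarrow> 'c \<Rightarrow>
    ('c \<Rightarrow> 'c \<Rightarrow> nat) \<Rightarrow> ('c \<Rightarrow> 'c) \<Rightarrow> ('c \<Rightarrow> 'c \<Rightarrow> 'c) \<Rightarrow> 'c coloured_int list set" where
  "restricted_partitions Csup Cfree Cinf cinfty c0 \<epsilon> \<delta> \<gamma> =
     {xs \<in> grounded_partitions (Csup \<union> Cfree \<union> Cinf) cinfty \<epsilon>.
        (\<forall>x\<in>set xs. snd x \<noteq> c0) \<and>
        (\<forall>ys\<in>forbidden_patterns Csup Cfree Cinf cinfty c0 \<epsilon> \<delta> \<gamma>. \<not> sublist ys xs) \<and>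
        (\<forall>p\<ge>0. \<forall>c'\<in>Cinf. \<not> prefix [(p, \<delta> c'), (p, c')] xs)}"

definition integer_partitions :: "int list set" where
  "integer_partitions = {ks. sorted_wrt (\<ge>) ks \<and> (\<forall>k\<in>set ks. k > 0)}"

definition total_size :: "'c coloured_int list \<Rightarrow> int" where
  "total_size xs = sum_list (map fst xs)"

text \<open>
  A product of colours is a monomial in commuting formal symbols, that is, an element of the
  free commutative monoid on the colours, represented by a multiset.
\<close>

definition colour_product :: "'c set \<Rightarrow> 'c coloured_int list \<Rightarrow> 'c multiset" where
  "colour_product D xs = filter_mset (\<lambda>c. c \<in> D) (mset (map snd xs))"

end

theory Submission imports Defs begin

text \<open>
  Cut a partition at its parts of non-free colour. It becomes a sequence of segments: lists of
  free parts \<open>F\<close> between two consecutive non-free parts \<open>x\<close> and \<open>y\<close> (or the ends of the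
  partition). Two free parts may follow each other as soon as they are equal or strictly
  decreasing in size, so the difference conditions inside a segment decouple: each free part only
  has to be compatible with \<open>x\<close> and \<open>y\<close>, and at most one colour occurs for each size. For each size
  \<open>p\<close> admissible between \<open>x\<close> and \<open>y\<close> there is one canonical colour, read off from \<open>\<gamma>\<close>, \<open>\<delta>\<close> or equal
  to \<open>c0\<close>, that can be inserted there whenever \<open>x\<close> and \<open>y\<close> may be adjacent. From a run of \<open>k\<close> equal
  parts of size \<open>p\<close> move all \<open>k\<close> copies of \<open>p\<close> to \<open>\<nu>\<close> if the colour is canonical, and \<open>k - 1\<close>
  copies otherwise. Every positive size is admissible in exactly one segment, so \<open>\<nu>\<close> can be
  redistributed, and the forbidden patterns say exactly that no free part is repeated or canonical.
\<close>

section \<open>Contexts, segments and the canonical colour of a size\<close>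

type_synonym 'c context_part = "'c coloured_int option"

locale coloured_setting =
  fixes Csup Cfree Cinf :: "'c set" and cinfty c0 :: 'c
    and \<epsilon> :: "'c \<Rightarrow> 'c \<Rightarrow> nat" and \<delta> :: "'c \<Rightarrow> 'c" and \<gamma> :: "'c \<Rightarrow> 'c \<Rightarrow> 'c"
  assumes colours: "colour_partition Csup Cfree Cinf cinfty"
    and eps: "well_defined_eps Csup Cfree Cinf cinfty \<epsilon>"
    and delta: "delta_witness Csup Cfree Cinf \<epsilon> \<delta>"
    and gamma: "gamma_witness Csup Cfree Cinf \<epsilon> \<gamma>"
    and c0_free: "c0 \<in> Cfree"
    and c0_eps: "\<forall>c\<in>(Csup \<union> Cfree \<union> Cinf) - {c0}. \<epsilon> c0 c = 1 \<and> \<epsilon> c c0 = 1"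
begin

abbreviation "C \<equiv> Csup \<union> Cfree \<union> Cinf"
abbreviation "ground \<equiv> (0 :: int, cinfty)"

text \<open>
  A context is the part preceding the list under consideration; \<open>None\<close> means that the list starts
  the partition.
\<close>

definition chain :: "'c context_part \<Rightarrow> 'c coloured_int list \<Rightarrow> bool" where
  "chain x L \<longleftrightarrow> successively (gg \<epsilon>) ((case x of None \<Rightarrow> [] | Some a \<Rightarrow> [a]) @ L)"

definition gg_context :: "'c context_part \<Rightarrow> 'c coloured_int \<Rightarrow> bool" where
  "gg_context x y \<longleftrightarrow> (case x of None \<Rightarrow> True | Some a \<Rightarrow> gg \<epsilon> a y)"

definition right_end :: "'c coloured_int \<Rightarrow> bool" where
  "right_end y \<longleftrightarrow> snd y \<in> Csup \<union> Cinf \<or> y = ground"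

definition left_end :: "'c context_part \<Rightarrow> bool" where
  "left_end x \<longleftrightarrow> (case x of None \<Rightarrow> True | Some a \<Rightarrow> snd a \<in> Csup \<union> Cinf)"

text \<open>
  Parts of equal size can only come in the order sup, free, inf. So \<open>above y p\<close> says that a free
  part of size \<open>p\<close> is placed before the non-free part \<open>y\<close>, and otherwise it is placed after \<open>y\<close>.
\<close>

definition above :: "'c coloured_int \<Rightarrow> int \<Rightarrow> bool" where
  "above y p \<longleftrightarrow> fst y < p \<or> fst y = p \<and> snd y \<in> Cinf"

text \<open>The segment between \<open>x\<close> and \<open>y\<close> owns the sizes that are
  \<open>below x\<close> and \<open>above y\<close>. As complement of \<open>above\<close>, this
  makes consecutive segments share no size.\<close>

definition below :: "'c context_part \<Rightarrow> int \<Rightarrow> bool" where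
  "below x p \<longleftrightarrow> (case x of None \<Rightarrow> True | Some a \<Rightarrow> \<not> above a p)"

definition fits :: "'c context_part \<Rightarrow> 'c coloured_int \<Rightarrow> 'c coloured_int \<Rightarrow> bool" where
  "fits x y z \<longleftrightarrow> snd z \<in> Cfree \<and> gg_context x z \<and> gg \<epsilon> z y"

abbreviation tame :: "'c coloured_int list \<Rightarrow> bool" where
  "tame \<equiv> sorted_wrt (\<lambda>a b. a = b \<or> fst b < fst a)"

text \<open>On free parts \<open>gg\<close> is the transitive relation used in \<open>tame\<close>.
  Free parts may separate two ends that cannot be adjacent, hence \<open>gg_context x y\<close> is
  asked of the empty segment only.\<close>

definition segment :: "'c context_part \<Rightarrow> 'c coloured_int \<Rightarrow> 'c coloured_int list \<Rightarrow> bool" where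
  "segment x y F \<longleftrightarrow> tame F \<and> (\<forall>z\<in>set F. fits x y z) \<and> (F = [] \<longrightarrow> gg_context x y)"

text \<open>
  The value is \<open>None\<close> exactly when \<open>x\<close> and \<open>y\<close> need a free part of size \<open>p\<close> between them; then no colour
  of that size may be removed completely.
\<close>

definition canonical :: "'c context_part \<Rightarrow> 'c coloured_int \<Rightarrow> int \<Rightarrow> 'c option" where
  "canonical x y p =
    (let c = snd (the x); c' = snd y; inf_right = (fst y = p \<and> c' \<in> Cinf) in
     if x \<noteq> None \<and> fst (the x) = p \<and> c \<in> Csup then
       (if inf_right then (if \<epsilon> c c' = 0 then Some (\<gamma> c c') else None)
        else if fst y = p - 1 \<and> c' \<in> Csup then (if \<epsilon> c c' \<le> 1 then Some (\<gamma> c c') else None)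
        else Some (\<delta> c))
     else if inf_right then
       (if x \<noteq> None \<and> fst (the x) = p + 1 \<and> c \<in> Cinf
        then (if \<epsilon> c c' \<le> 1 then Some (\<gamma> c c') else None)
        else Some (\<delta> c'))
     else Some c0)"

subsection \<open>Difference conditions\<close>

lemma colours_disjoint:
  "(c \<notin> Csup \<or> c \<notin> Cfree) \<and> (c \<notin> Csup \<or> c \<notin> Cinf) \<and> (c \<notin> Cfree \<or> c \<notin> Cinf)"
  using colours unfolding colour_partition_def by auto

lemma infty_not_colour [simp]: "cinfty \<notin> Csup" "cinfty \<notin> Cfree" "cinfty \<notin> Cinf"
  using colours unfolding colour_partition_def by auto

lemma eps_free_free: "c \<in> Cfree \<Longrightarrow> c' \<in> Cfree \<Longrightarrow> \<epsilon> c c' = (if c \<noteq> c' then 1 else 0)"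
  and eps_sup_free: "c \<in> Csup \<Longrightarrow> c' \<in> Cfree \<Longrightarrow> \<epsilon> c c' \<le> 1"
  and eps_free_sup: "c \<in> Cfree \<Longrightarrow> c' \<in> Csup \<Longrightarrow> 1 \<le> \<epsilon> c c' \<and> \<epsilon> c c' \<le> 2"
  and eps_free_inf: "c \<in> Cfree \<Longrightarrow> c' \<in> Cinf \<Longrightarrow> \<epsilon> c c' \<le> 1"
  and eps_inf_free: "c \<in> Cinf \<Longrightarrow> c' \<in> Cfree \<Longrightarrow> 1 \<le> \<epsilon> c c' \<and> \<epsilon> c c' \<le> 2"
  and eps_sup_inf: "c \<in> Csup \<Longrightarrow> c' \<in> Cinf \<Longrightarrow> \<epsilon> c c' \<le> 1"
  and eps_inf_sup: "c \<in> Cinf \<Longrightarrow> c' \<in> Csup \<Longrightarrow> 1 \<le> \<epsilon> c c' \<and> \<epsilon> c c' \<le> 2"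
  and eps_sup_sup: "c \<in> Csup \<Longrightarrow> c' \<in> Csup \<Longrightarrow> \<epsilon> c c' \<le> 2"
  and eps_inf_inf: "c \<in> Cinf \<Longrightarrow> c' \<in> Cinf \<Longrightarrow> \<epsilon> c c' \<le> 2"
  and eps_free_infty: "c \<in> Cfree \<Longrightarrow> \<epsilon> c cinfty = 1"
  and eps_inf_infty: "c \<in> Cinf \<Longrightarrow> 1 \<le> \<epsilon> c cinfty \<and> \<epsilon> c cinfty \<le> 2"
  and eps_sup_infty: "c \<in> Csup \<Longrightarrow> \<epsilon> c cinfty \<le> 1"
proof -
  note E = eps[unfolded well_defined_eps_def]
  have 1: "\<forall>c\<in>C. \<forall>c'\<in>C \<union> {cinfty}. \<epsilon> c c' \<in> {0, 1, 2}"
    using E by (elim conjE)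
  have 2: "\<forall>c\<in>Cfree. \<forall>c'\<in>Cfree. \<epsilon> c c' = (if c \<noteq> c' then 1 else 0)"
    using E by (elim conjE)
  have 3: "\<forall>c\<in>Csup. \<forall>c'\<in>Cfree. \<epsilon> c c' \<in> {0, 1} \<and> \<epsilon> c' c \<in> {1, 2}"
    using E by (elim conjE)
  have 4: "\<forall>c\<in>Cfree. \<forall>c'\<in>Cinf. \<epsilon> c c' \<in> {0, 1} \<and> \<epsilon> c' c \<in> {1, 2}"
    using E by (elim conjE)
  have 5: "\<forall>c\<in>Csup. \<forall>c'\<in>Cinf. \<epsilon> c c' \<in> {0, 1} \<and> \<epsilon> c' c \<in> {1, 2} \<and>
      (\<epsilon> c c' = 0 \<longrightarrow> (\<exists>f\<in>Cfree. \<epsilon> c f = 0 \<and> \<epsilon> f c' = 0))"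
    using E by (elim conjE)
  have 6: "\<forall>f\<in>Cfree. \<epsilon> f cinfty = 1" using E by (elim conjE)
  have 7: "\<forall>c\<in>Cinf. \<epsilon> c cinfty \<in> {1, 2}" using E by (elim conjE)
  have 8: "\<forall>c\<in>Csup. \<epsilon> c cinfty \<in> {0, 1}" using E by (elim conjE)
  show "c \<in> Cfree \<Longrightarrow> c' \<in> Cfree \<Longrightarrow> \<epsilon> c c' = (if c \<noteq> c' then 1 else 0)" using 2 by blast
  show "c \<in> Csup \<Longrightarrow> c' \<in> Cfree \<Longrightarrow> \<epsilon> c c' \<le> 1" using 3 by fastforce
  show "c \<in> Cfree \<Longrightarrow> c' \<in> Csup \<Longrightarrow> 1 \<le> \<epsilon> c c' \<and> \<epsilon> c c' \<le> 2" using 3 by fastforce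
  show "c \<in> Cfree \<Longrightarrow> c' \<in> Cinf \<Longrightarrow> \<epsilon> c c' \<le> 1" using 4 by fastforce
  show "c \<in> Cinf \<Longrightarrow> c' \<in> Cfree \<Longrightarrow> 1 \<le> \<epsilon> c c' \<and> \<epsilon> c c' \<le> 2" using 4 by fastforce
  show "c \<in> Csup \<Longrightarrow> c' \<in> Cinf \<Longrightarrow> \<epsilon> c c' \<le> 1" using 5 by fastforce
  show "c \<in> Cinf \<Longrightarrow> c' \<in> Csup \<Longrightarrow> 1 \<le> \<epsilon> c c' \<and> \<epsilon> c c' \<le> 2" using 5 by fastforce
  show "c \<in> Csup \<Longrightarrow> c' \<in> Csup \<Longrightarrow> \<epsilon> c c' \<le> 2"
    using 1[rule_format, of c c'] by auto
  show "c \<in> Cinf \<Longrightarrow> c' \<in> Cinf \<Longrightarrow> \<epsilon> c c' \<le> 2"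
    using 1[rule_format, of c c'] by auto
  show "c \<in> Cfree \<Longrightarrow> \<epsilon> c cinfty = 1" using 6 by blast
  show "c \<in> Cinf \<Longrightarrow> 1 \<le> \<epsilon> c cinfty \<and> \<epsilon> c cinfty \<le> 2" using 7 by fastforce
  show "c \<in> Csup \<Longrightarrow> \<epsilon> c cinfty \<le> 1" using 8 by fastforce
qed

lemma delta_sup: "c \<in> Csup \<Longrightarrow> \<delta> c \<in> Cfree \<and> \<epsilon> c (\<delta> c) = 0"
  and delta_inf: "c \<in> Cinf \<Longrightarrow> \<delta> c \<in> Cfree \<and> \<epsilon> (\<delta> c) c = 0"
  using delta unfolding delta_witness_def by auto

lemma gamma_eps_sup_inf: "c \<in> Csup \<Longrightarrow> c' \<in> Cinf \<Longrightarrow> \<epsilon> c c' = 0 \<Longrightarrow>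
    \<gamma> c c' \<in> Cfree \<and> \<epsilon> c (\<gamma> c c') = 0 \<and> \<epsilon> (\<gamma> c c') c' = 0"
  and gamma_eps_sup_sup: "c \<in> Csup \<Longrightarrow> c' \<in> Csup \<Longrightarrow> \<epsilon> c c' \<le> 1 \<Longrightarrow>
    \<gamma> c c' \<in> Cfree \<and> \<epsilon> c (\<gamma> c c') = 0 \<and> \<epsilon> (\<gamma> c c') c' = 1"
  and gamma_eps_inf_inf: "c \<in> Cinf \<Longrightarrow> c' \<in> Cinf \<Longrightarrow> \<epsilon> c c' \<le> 1 \<Longrightarrow>
    \<gamma> c c' \<in> Cfree \<and> \<epsilon> c (\<gamma> c c') = 1 \<and> \<epsilon> (\<gamma> c c') c' = 0"
  using gamma unfolding gamma_witness_def by (auto simp: le_Suc_eq)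

lemma c0_left: "c \<in> Csup \<union> Cinf \<Longrightarrow> \<epsilon> c c0 = 1" and c0_right: "c \<in> Csup \<union> Cinf \<Longrightarrow> \<epsilon> c0 c = 1"
  using c0_eps c0_free colours_disjoint[of c] by auto

lemma gg_free: "snd a \<in> Cfree \<Longrightarrow> snd b \<in> Cfree \<Longrightarrow> gg \<epsilon> a b \<longleftrightarrow> a = b \<or> fst b < fst a"
  by (cases a; cases b) (auto simp: gg_def eps_free_free)

text \<open>For a fixed colour on the left, \<epsilon> into \<open>Cfree\<close> stays within {0, 1}
  or within {1, 2}. Changing the free colour raises the required gap by at most 1, which the strict
  descent from \<open>z\<close> to \<open>z'\<close> pays for.\<close>

lemma gg_trans_left:
  assumes "snd x \<in> C" "snd z \<in> Cfree" "snd z' \<in> Cfree" "gg \<epsilon> x z" "gg \<epsilon> z z'"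
  shows "gg \<epsilon> x z'"
proof (cases "z = z'")
  case False
  then have "fst z' < fst z" using assms gg_free by blast
  moreover have "\<epsilon> (snd x) (snd z') \<le> \<epsilon> (snd x) (snd z) + 1"
    using assms(1) eps_free_free[OF _ assms(2)] eps_free_free[OF _ assms(3)]
      eps_sup_free[OF _ assms(2)] eps_sup_free[OF _ assms(3)]
      eps_inf_free[OF _ assms(2)] eps_inf_free[OF _ assms(3)] by force
  ultimately show ?thesis using assms(4) by (auto simp: gg_def)
qed (use assms in simp)

lemma gg_trans_right:
  assumes "snd y \<in> C \<union> {cinfty}" "snd z \<in> Cfree" "snd z' \<in> Cfree" "gg \<epsilon> z z'" "gg \<epsilon> z' y"
  shows "gg \<epsilon> z y"
proof (cases "z = z'")
  case False
  then have "fst z' < fst z" using assms gg_free by blast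
  moreover have "\<epsilon> (snd z) (snd y) \<le> \<epsilon> (snd z') (snd y) + 1"
    using assms(1) eps_free_free[OF assms(2)] eps_free_free[OF assms(3)]
      eps_free_sup[OF assms(2)] eps_free_sup[OF assms(3)]
      eps_free_inf[OF assms(2)] eps_free_inf[OF assms(3)]
      eps_free_infty[OF assms(2)] eps_free_infty[OF assms(3)] by force
  ultimately show ?thesis using assms(5) by (auto simp: gg_def)
qed (use assms in simp)

lemma right_end_cases:
  assumes "right_end y"
  obtains (sup) q c where "y = (q, c)" "c \<in> Csup" | (inf) q c where "y = (q, c)" "c \<in> Cinf"
  | (ground) "y = ground"
  using assms unfolding right_end_def by (cases y) auto

lemma left_end_cases:
  assumes "left_end x"
  obtains (None) "x = None" | (sup) q c where "x = Some (q, c)" "c \<in> Csup"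
  | (inf) q c where "x = Some (q, c)" "c \<in> Cinf"
  using assms unfolding left_end_def by (cases x) auto

section \<open>Which free colours fit between two non-free ends\<close>

lemmas segment_defs = canonical_def fits_def gg_context_def gg_def below_def above_def

text \<open>Only ends close to \<open>p\<close> restrict the colour. A sup part of size
  \<open>p\<close> on the left, or an inf part of size \<open>p\<close> on the right, needs
  \<epsilon> equal to 0 on its side, which \<open>\<delta>\<close> provides. If the other end is
  tight as well, adjacency of \<open>x\<close> and \<open>y\<close> bounds
  \<open>\<epsilon> c c'\<close> as \<open>\<gamma>\<close> requires. In all other cases both gaps
  are at least 1, enough for \<open>c0\<close>.\<close>

lemma canonical_fits:
  assumes "left_end x" "right_end y" "gg_context x y" "below x p" "above y p"
  shows "\<exists>f. canonical x y p = Some f \<and> fits x y (p, f)"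
  using assms(1)
proof (cases rule: left_end_cases)
  case None
  from assms(2) show ?thesis
  proof (cases rule: right_end_cases)
    case s: (sup q' c')
    then show ?thesis using assms(3-) None colours_disjoint[of "snd (the x)"] colours_disjoint[of "snd y"] c0_right[of c'] c0_free by (simp add: segment_defs)
  next
    case i: (inf q' c')
    then show ?thesis using assms(3-) None colours_disjoint[of "snd (the x)"] colours_disjoint[of "snd y"] c0_right[of c'] c0_free delta_inf[of c']
      by (auto simp: segment_defs)
  next
    case ground
    then show ?thesis using assms(3-) None colours_disjoint[of "snd (the x)"] colours_disjoint[of "snd y"] c0_free eps_free_infty[of c0] by (simp add: segment_defs)
  qed
next
  case (sup q c)
  note D = delta_sup[OF sup(2)]
  from assms(2) show ?thesis
  proof (cases rule: right_end_cases)
    case s: (sup q' c')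
    show ?thesis
      using assms(3-) sup colours_disjoint[of "snd (the x)"] colours_disjoint[of "snd y"] s D c0_left[of c] c0_right[of c'] c0_free
        eps_free_sup[OF conjunct1[OF D] s(2)] gamma_eps_sup_sup[OF sup(2) s(2)]
      by (auto simp: segment_defs)
  next
    case i: (inf q' c')
    show ?thesis
      using assms(3-) sup colours_disjoint[of "snd (the x)"] colours_disjoint[of "snd y"] i D c0_left[of c] c0_right[of c'] c0_free delta_inf[OF i(2)]
        eps_free_inf[OF conjunct1[OF D] i(2)] gamma_eps_sup_inf[OF sup(2) i(2)]
        eps_sup_free[OF sup(2), of "\<delta> c'"]
      by (auto simp: segment_defs)
  next
    case ground
    show ?thesis
      using assms(3-) sup colours_disjoint[of "snd (the x)"] colours_disjoint[of "snd y"] ground D c0_left[of c] c0_free eps_free_infty[of c0]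
        eps_free_infty[OF conjunct1[OF D]]
      by (auto simp: segment_defs)
  qed
next
  case (inf q c)
  from assms(2) show ?thesis
  proof (cases rule: right_end_cases)
    case s: (sup q' c')
    show ?thesis
      using assms(3-) inf colours_disjoint[of "snd (the x)"] colours_disjoint[of "snd y"] s c0_left[of c] c0_right[of c'] c0_free
      by (auto simp: segment_defs)
  next
    case i: (inf q' c')
    note D = delta_inf[OF i(2)]
    show ?thesis
      using assms(3-) inf colours_disjoint[of "snd (the x)"] colours_disjoint[of "snd y"] i D c0_left[of c] c0_right[of c'] c0_free
        eps_inf_free[OF inf(2) conjunct1[OF D]] gamma_eps_inf_inf[OF inf(2) i(2)]
      by (auto simp: segment_defs)
  next
    case ground
    show ?thesis
      using assms(3-) inf colours_disjoint[of "snd (the x)"] colours_disjoint[of "snd y"] ground c0_left[of c] c0_free eps_free_infty[of c0]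
      by (auto simp: segment_defs)
  qed
qed

text \<open>From inf to free, from free to sup and from free to \<open>cinfty\<close>, \<epsilon> is
  at least 1. So a free part can equal an end in size only after a sup part or before an inf
  part.\<close>

lemma fits_range:
  assumes "left_end x" "right_end y" "fits x y z"
  shows "below x (fst z)" "above y (fst z)"
proof -
  have z: "snd z \<in> Cfree" using assms(3) by (simp add: fits_def)
  show "below x (fst z)"
    using assms(1)
  proof (cases rule: left_end_cases)
    case (inf q c)
    then show ?thesis using assms(3) colours_disjoint[of "snd (the x)"] colours_disjoint[of "snd y"] eps_inf_free[OF inf(2) z] by (auto simp: segment_defs)
  qed (use assms(3) colours_disjoint[of "snd (the x)"] in \<open>auto simp: segment_defs\<close>)
  show "above y (fst z)"
    using assms(2)
  proof (cases rule: right_end_cases)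
    case (sup q c)
    then show ?thesis using assms(3) colours_disjoint[of "snd (the x)"] colours_disjoint[of "snd y"] eps_free_sup[OF z sup(2)] by (auto simp: segment_defs)
  qed (use assms(3) colours_disjoint[of "snd y"] eps_free_infty[OF z] in \<open>auto simp: segment_defs\<close>)
qed

text \<open>
  If \<open>x\<close> and \<open>y\<close> cannot be adjacent, then only one size fits between them and it has no canonical
  colour, so reducing a segment never empties it illegally.
\<close>

lemma tight_gap:
  assumes "left_end x" "right_end y" "fits x y z" "\<not> gg_context x y"
  shows "canonical x y (fst z) = None" and "below x p \<Longrightarrow> above y p \<Longrightarrow> p = fst z"
proof -
  note R = fits_range[OF assms(1-3)]
  \<comment> \<open>Non-adjacency makes the size gap smaller than \<epsilon>, while a fitting size
    forces a minimal gap. What survives is two sup parts or two inf parts at distance 1 with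
    \<epsilon> equal to 2, and sup before inf at distance 0 with \<epsilon> equal to 1; all other
    pairs are contradictory.\<close>
  have "canonical x y (fst z) = None \<and> (below x p \<longrightarrow> above y p \<longrightarrow> p = fst z)"
    using assms(1)
  proof (cases rule: left_end_cases)
    case None
    with assms show ?thesis by (simp add: gg_context_def)
  next
    case (sup q c)
    from assms(2) show ?thesis
    proof (cases rule: right_end_cases)
      case s: (sup q' c')
      then show ?thesis using sup R assms(4) colours_disjoint[of "snd (the x)"] colours_disjoint[of "snd y"] eps_sup_sup[OF sup(2) s(2)] by (auto simp: segment_defs)
    next
      case i: (inf q' c')
      then show ?thesis using sup R assms(4) colours_disjoint[of "snd (the x)"] colours_disjoint[of "snd y"] eps_sup_inf[OF sup(2) i(2)] by (auto simp: segment_defs)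
    next
      case ground
      then show ?thesis using sup R assms(4) colours_disjoint[of "snd (the x)"] colours_disjoint[of "snd y"] eps_sup_infty[OF sup(2)] by (auto simp: segment_defs)
    qed
  next
    case (inf q c)
    from assms(2) show ?thesis
    proof (cases rule: right_end_cases)
      case s: (sup q' c')
      then show ?thesis using inf R assms(4) colours_disjoint[of "snd (the x)"] colours_disjoint[of "snd y"] eps_inf_sup[OF inf(2) s(2)] by (auto simp: segment_defs)
    next
      case i: (inf q' c')
      then show ?thesis using inf R assms(4) colours_disjoint[of "snd (the x)"] colours_disjoint[of "snd y"] eps_inf_inf[OF inf(2) i(2)] by (auto simp: segment_defs)
    next
      case ground
      then show ?thesis using inf R assms(4) colours_disjoint[of "snd (the x)"] colours_disjoint[of "snd y"] eps_inf_infty[OF inf(2)] by (auto simp: segment_defs)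
    qed
  qed
  then show "canonical x y (fst z) = None" "below x p \<Longrightarrow> above y p \<Longrightarrow> p = fst z" by auto
qed

text \<open>The sets of sizes \<open>above\<close> successive non-free parts increase. A free part
  in between separates the two sets; if there is none, the critical case is an inf part before a
  part that is not inf, where \<epsilon> at least 1 forces a strict descent.\<close>

lemma segment_above_mono:
  assumes "left_end (Some a)" "right_end y" "segment (Some a) y F" "above a p"
  shows "above y p"
proof (cases F)
  case Nil
  then have "gg \<epsilon> a y" using assms(3) by (simp add: segment_def gg_context_def)
  moreover have "1 \<le> \<epsilon> (snd a) (snd y)" if "snd a \<in> Cinf" "snd y \<notin> Cinf"
    using that assms(2) eps_inf_sup[OF that(1)] eps_inf_infty[OF that(1)] by (auto simp: right_end_def)
  ultimately show ?thesis using assms(4) by (cases "snd y \<in> Cinf") (auto simp: gg_def above_def)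
next
  case (Cons z F')
  then have "fits (Some a) y z" using assms(3) by (simp add: segment_def)
  from fits_range[OF assms(1,2) this] show ?thesis
    using assms(4) by (auto simp: below_def above_def)
qed

subsection \<open>Decomposition into segments\<close>

text \<open>By transitivity only neighbours matter: compatibility with \<open>x\<close> passes from
  \<open>z\<close> to all of \<open>F\<close>, and compatibility with \<open>y\<close> passes back
  from the first part of \<open>F\<close> to \<open>z\<close>.\<close>

lemma segment_Cons:
  assumes "case x of None \<Rightarrow> True | Some a \<Rightarrow> snd a \<in> C" "snd z \<in> Cfree" "snd y \<in> C \<union> {cinfty}"
  shows "segment x y (z # F) \<longleftrightarrow> gg_context x z \<and> segment (Some z) y F"
proof
  assume "segment x y (z # F)"
  then show "gg_context x z \<and> segment (Some z) y F"
    using assms by (auto simp: segment_def fits_def gg_context_def gg_free)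
next
  assume A: "gg_context x z \<and> segment (Some z) y F"
  have "gg_context x z'" if "z' \<in> set F" for z'
    using A that assms gg_trans_left[of _ z z']
    by (auto simp: segment_def fits_def gg_context_def split: option.splits)
  moreover have "gg \<epsilon> z y"
  proof (cases F)
    case (Cons z' F')
    then show ?thesis using A assms gg_trans_right[of y z z'] by (auto simp: segment_def fits_def gg_context_def)
  qed (use A in \<open>simp add: segment_def gg_context_def\<close>)
  ultimately show "segment x y (z # F)"
    using A assms by (auto simp: segment_def fits_def gg_context_def gg_free)
qed

lemma chain_Cons: "chain x (y # T) \<longleftrightarrow> gg_context x y \<and> chain (Some y) T"
  by (cases x; cases T) (auto simp: chain_def gg_context_def)

lemma chain_segment:
  assumes "case x of None \<Rightarrow> True | Some a \<Rightarrow> snd a \<in> C" "\<forall>z\<in>set F. snd z \<in> Cfree" "snd y \<in> C \<union> {cinfty}"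
  shows "chain x (F @ y # T) \<longleftrightarrow> segment x y F \<and> chain (Some y) T"
  using assms(1,2)
proof (induction F arbitrary: x)
  case Nil
  then show ?case by (simp add: chain_Cons segment_def)
next
  case (Cons z F)
  then show ?case using segment_Cons[of x z y F] assms(3) Cons.IH[of "Some z"]
    by (auto simp: chain_Cons)
qed

text \<open>Recursion over the non-free parts, so that later inductions proceed by whole segments;
  the ground part closes the last one.\<close>

inductive valid :: "'c context_part \<Rightarrow> 'c coloured_int list \<Rightarrow> bool" where
  valid_ground: "segment x ground F \<Longrightarrow> valid x (F @ [ground])"
| valid_part: "segment x y F \<Longrightarrow> snd y \<in> Csup \<union> Cinf \<Longrightarrow> valid (Some y) T \<Longrightarrow> valid x (F @ y # T)"

lemma segment_free: "segment x y F \<Longrightarrow> z \<in> set F \<Longrightarrow> snd z \<in> Cfree"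
  by (simp add: segment_def fits_def)

lemma left_end_C: "left_end x \<Longrightarrow> case x of None \<Rightarrow> True | Some a \<Rightarrow> snd a \<in> C"
  by (auto simp: left_end_def split: option.splits)

lemma valid_if_chain:
  assumes "left_end x" "\<forall>z\<in>set xs. snd z \<in> C" "chain x (xs @ [ground])"
  shows "valid x (xs @ [ground])"
  using assms
proof (induction "length xs" arbitrary: x xs rule: less_induct)
  case less
  let ?F = "takeWhile (\<lambda>z. snd z \<in> Cfree) xs"
  have F: "\<forall>z\<in>set ?F. snd z \<in> Cfree" by (auto dest: set_takeWhileD)
  show ?case
  proof (cases "dropWhile (\<lambda>z. snd z \<in> Cfree) xs")
    case Nil
    then have "?F = xs" by (metis append_Nil2 takeWhile_dropWhile_id)
    with F have "segment x ground xs" using chain_segment[OF left_end_C[OF less.prems(1)], of xs ground "[]"] less.prems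
      by auto
    then show ?thesis by (rule valid_ground)
  next
    case (Cons y T)
    then have xs: "xs = ?F @ y # T" by (metis takeWhile_dropWhile_id)
    then have "y \<in> set xs" by (metis in_set_conv_decomp)
    moreover have "snd y \<notin> Cfree" using Cons by (metis hd_dropWhile list.sel(1) list.distinct(1))
    ultimately have y: "snd y \<in> Csup \<union> Cinf" using less.prems(2) by auto
    have "chain x (?F @ y # (T @ [ground]))" using less.prems(3) xs by (metis append.assoc append_Cons)
    then have 1: "segment x y ?F" "chain (Some y) (T @ [ground])"
      using chain_segment[OF left_end_C[OF less.prems(1)] F, of y "T @ [ground]"] y by auto
    have "valid (Some y) (T @ [ground])"
    proof (rule less.hyps)
      show "length T < length xs" by (subst xs) simp
      show "left_end (Some y)" using y by (simp add: left_end_def)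
      show "\<forall>z\<in>set T. snd z \<in> C" using less.prems(2) by (subst (asm) xs) auto
    qed (fact 1)
    from valid_part[OF 1(1) y this] show ?thesis using xs by (metis append.assoc append_Cons)
  qed
qed

lemma chain_if_valid:
  assumes "valid x L" "left_end x"
  shows "chain x L \<and> (\<exists>xs. L = xs @ [ground] \<and> (\<forall>z\<in>set xs. snd z \<in> C))"
  using assms
proof induction
  case (valid_ground x F)
  then show ?case using chain_segment[OF left_end_C, of x F ground "[]"] segment_free
    by (auto simp: chain_def)
next
  case (valid_part x y F T)
  then obtain xs where "T = xs @ [ground]" "\<forall>z\<in>set xs. snd z \<in> C" "chain (Some y) T"
    by (auto simp: left_end_def)
  then show ?case using valid_part chain_segment[OF left_end_C, of x F y T] segment_free[OF valid_part(1)]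
    by (auto intro!: exI[of _ "F @ y # xs"])
qed

lemma grounded_iff_valid: "L \<in> grounded_partitions C cinfty \<epsilon> \<longleftrightarrow> valid None L"
  using valid_if_chain[of None] chain_if_valid[of None L]
  by (auto simp: grounded_partitions_def chain_def left_end_def)

section \<open>Positivity of sizes\<close>

lemma segment_positive:
  assumes "left_end x" "right_end y" "segment x y F" "\<And>p. above y p \<Longrightarrow> 0 < p"
  shows "x = Some a \<Longrightarrow> above a p \<Longrightarrow> 0 < p" "z \<in> set F \<Longrightarrow> 0 < fst z"
proof -
  show "0 < p" if "x = Some a" "above a p"
    using segment_above_mono[of a y F p] that assms by blast
  show "0 < fst z" if "z \<in> set F"
    using fits_range(2)[OF assms(1,2), of z] assms(3,4) that by (auto simp: segment_def)
qed

lemma above_ground [simp]: "above ground p \<longleftrightarrow> 0 < p"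
  by (simp add: above_def)

lemma right_end_ground [simp]: "right_end ground"
  by (simp add: right_end_def)

lemma nonfree_ends: "snd y \<in> Csup \<union> Cinf \<Longrightarrow> right_end y \<and> left_end (Some y)"
  by (simp add: left_end_def right_end_def)

text \<open>Positivity travels leftwards from the ground part, because the sizes
  \<open>above\<close> a part are also \<open>above\<close> the next non-free part. The first
  conjunct is what the induction needs; it also shows that the sizes moved to \<nu> are
  positive.\<close>

lemma valid_positive:
  assumes "valid x L" "left_end x"
  shows "(\<forall>a p. x = Some a \<longrightarrow> above a p \<longrightarrow> 0 < p) \<and> (\<forall>z\<in>set L. snd z \<in> Cfree \<longrightarrow> 0 < fst z)"
  using assms
proof induction
  case (valid_ground x F)
  have P: "0 < p" if "above ground p" for p using that by simp
  show ?case
    using segment_positive[OF valid_ground.prems right_end_ground valid_ground.hyps P] by auto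
next
  case (valid_part x y F T)
  have y: "right_end y" "left_end (Some y)" using nonfree_ends[OF valid_part(2)] by auto
  note IH = valid_part.IH[OF y(2)]
  have P: "0 < p" if "above y p" for p using that IH by blast
  have "snd y \<notin> Cfree" using valid_part(2) colours_disjoint[of "snd y"] by auto
  then show ?case
    using segment_positive[OF valid_part.prems y(1) valid_part(1) P] IH by auto
qed

subsection \<open>The bijection on one segment\<close>

text \<open>Equal parts of a tame list are consecutive, so \<open>remdups\<close> leaves one copy of
  each run; the filter then drops the canonical copies.\<close>

definition reduce :: "'c context_part \<Rightarrow> 'c coloured_int \<Rightarrow> 'c coloured_int list \<Rightarrow> 'c coloured_int list" where
  "reduce x y F = filter (\<lambda>z. canonical x y (fst z) \<noteq> Some (snd z)) (remdups F)"

text \<open>Inverse of \<open>reduce\<close> once the removed sizes \<open>N\<close> are known: a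
  size still present in \<open>F\<close> keeps its colour there, and a size that has vanished had
  the canonical colour.\<close>

definition expand ::
    "'c context_part \<Rightarrow> 'c coloured_int \<Rightarrow> 'c coloured_int list \<Rightarrow> int multiset \<Rightarrow> 'c coloured_int list" where
  "expand x y F N =
     map (\<lambda>p. (p, case map_of F p of Some f \<Rightarrow> f | None \<Rightarrow> the (canonical x y p)))
       (rev (sorted_list_of_multiset (N + mset (map fst F))))"

definition reduced :: "'c context_part \<Rightarrow> 'c coloured_int \<Rightarrow> 'c coloured_int list \<Rightarrow> bool" where
  "reduced x y F \<longleftrightarrow> segment x y F \<and> distinct F \<and> (\<forall>z\<in>set F. canonical x y (fst z) \<noteq> Some (snd z))"

definition split_segment :: "'c context_part \<Rightarrow> 'c coloured_int \<Rightarrow> 'c coloured_int list \<Rightarrow>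
    'c coloured_int list \<Rightarrow> int multiset \<Rightarrow> bool" where
  "split_segment x y F F' N \<longleftrightarrow>
     segment x y F \<and> F' = reduce x y F \<and> mset (map fst F) = N + mset (map fst F')"

lemma tame_same_size: "tame F \<Longrightarrow> (p, f) \<in> set F \<Longrightarrow> (p, g) \<in> set F \<Longrightarrow> f = g"
  by (induction F) auto

lemma tame_remdups: "tame F \<Longrightarrow> tame (remdups F)"
  by (induction F) auto

lemma tame_distinct_fst: "tame F \<Longrightarrow> distinct F \<Longrightarrow> distinct (map fst F)"
  by (induction F) auto

lemma tame_sorted_fst: "tame F \<Longrightarrow> sorted (rev (map fst F))"
  by (simp add: sorted_wrt_rev sorted_wrt_map) (erule sorted_wrt_mono_rel[rotated], auto)

text \<open>Without repetitions the sizes strictly decrease, so the set of parts fixes their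
  order.\<close>

lemma tame_unique:
  assumes "tame F" "tame G" "distinct F" "distinct G" "set F = set G"
  shows "F = G"
proof -
  have "rev F = rev G"
  proof (rule map_sorted_distinct_set_unique[of fst])
    show "inj_on fst (set (rev F) \<union> set (rev G))"
      using assms(1,5) tame_same_size by (fastforce simp: inj_on_def)
  qed (use assms tame_sorted_fst tame_distinct_fst in \<open>simp_all add: rev_map[symmetric]\<close>)
  then show ?thesis by simp
qed

text \<open>The point is that reduction cannot empty a segment whose ends are not adjacent: there no
  part is canonical, by \<open>tight_gap\<close>.\<close>

lemma reduce_reduced:
  assumes "left_end x" "right_end y" "segment x y F"
  shows "reduced x y (reduce x y F)"
proof -
  have "gg_context x y" if "reduce x y F = []"
  proof (rule ccontr)
    assume n: "\<not> gg_context x y"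
    then obtain z where z: "z \<in> set F" using assms(3) by (cases F) (auto simp: segment_def)
    then have "canonical x y (fst z) = None"
      using tight_gap(1)[OF assms(1,2) _ n] assms(3) by (auto simp: segment_def)
    with z that show False by (auto simp: reduce_def filter_empty_conv)
  qed
  then show ?thesis
    using assms(3) by (auto simp: reduced_def segment_def reduce_def sorted_wrt_filter tame_remdups)
qed

lemma split_segment_total:
  assumes "segment x y F"
  shows "\<exists>F' N. split_segment x y F F' N"
proof -
  have "mset (reduce x y F) \<subseteq># mset F"
    unfolding reduce_def mset_filter
    by (rule subset_mset.order_trans[OF multiset_filter_subset mset_remdups_subset_eq])
  then have "mset (map fst (reduce x y F)) \<subseteq># mset (map fst F)"
    by (simp add: image_mset_subseteq_mono)
  then show ?thesis using assms unfolding split_segment_def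
    by (metis subset_mset.diff_add)
qed

lemma split_segment_range:
  assumes "left_end x" "right_end y" "split_segment x y F F' N" "p \<in># N"
  shows "below x p" "above y p"
proof -
  have "p \<in># mset (map fst F)" using assms(3,4) by (simp add: split_segment_def)
  then obtain z where "z \<in> set F" "fst z = p" by auto
  then show "below x p" "above y p"
    using fits_range[OF assms(1,2), of z] assms(3) by (auto simp: split_segment_def segment_def)
qed

text \<open>A tame list is determined by its multiset of sizes and the colour of each size. Each
  colour is either retained in \<open>F'\<close> or was removed for being canonical.\<close>

lemma expand_split:
  assumes "split_segment x y F F' N"
  shows "expand x y F' N = F"
proof -
  have t: "tame F" and F': "F' = reduce x y F" and N: "N + mset (map fst F') = mset (map fst F)"
    using assms by (auto simp: split_segment_def segment_def)
  have "rev (sorted_list_of_multiset (mset (map fst F))) = map fst F"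
    using tame_sorted_fst[OF t] by (metis mset_rev rev_rev_ident sorted_list_of_multiset_mset sorted_sort_id)
  moreover have "(case map_of F' p of Some f \<Rightarrow> f | None \<Rightarrow> the (canonical x y p)) = f"
    if pf: "(p, f) \<in> set F" for p f
  proof (cases "map_of F' p")
    case None
    then have "(p, f) \<notin> set F'" by (force simp: map_of_eq_None_iff)
    then show ?thesis using None pf by (auto simp: F' reduce_def)
  next
    case (Some g)
    then have "(p, g) \<in> set F" using map_of_SomeD[OF Some] by (auto simp: F' reduce_def)
    then show ?thesis using tame_same_size[OF t pf] Some by auto
  qed
  ultimately show ?thesis
    unfolding expand_def N by (simp only: map_map comp_def) (rule map_idI, simp add: prod_eq_iff)
qed

text \<open>Sizes of \<open>N\<close> already in \<open>F'\<close> only lengthen runs. Any other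
  size enters with its canonical colour, so \<open>reduce\<close> takes out exactly what was
  inserted.\<close>

lemma split_expand:
  assumes "left_end x" "right_end y" "reduced x y F'" "\<And>p. p \<in># N \<Longrightarrow> below x p \<and> above y p"
  shows "split_segment x y (expand x y F' N) F' N"
proof -
  define col where "col = (\<lambda>p. case map_of F' p of Some f \<Rightarrow> f | None \<Rightarrow> the (canonical x y p))"
  let ?F = "expand x y F' N"
  have red: "tame F'" "distinct F'" "\<And>z. z \<in> set F' \<Longrightarrow> fits x y z" "F' = [] \<Longrightarrow> gg_context x y"
      "\<And>z. z \<in> set F' \<Longrightarrow> canonical x y (fst z) \<noteq> Some (snd z)"
    using assms(3) by (auto simp: reduced_def segment_def)
  have map_F: "?F = map (\<lambda>p. (p, col p)) (rev (sorted_list_of_multiset (N + mset (map fst F'))))"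
    by (simp only: expand_def col_def)
  have set_F: "set ?F = (\<lambda>p. (p, col p)) ` (set_mset N \<union> fst ` set F')"
    unfolding map_F
    by (simp only: set_map set_rev set_sorted_list_of_multiset set_mset_union set_mset_mset)
  have F': "col p = f" if "(p, f) \<in> set F'" for p f
    using that tame_distinct_fst[OF red(1,2)] by (simp add: col_def)
  have new: "\<exists>f. canonical x y p = Some f \<and> col p = f \<and> fits x y (p, f)"
    if "p \<in># N" "p \<notin> fst ` set F'" for p
  proof -
    \<comment> \<open>Otherwise \<open>F'\<close> is non-empty and its part has the only size that
      fits, so \<open>p\<close> would occur in \<open>F'\<close>.\<close>
    have "gg_context x y"
    proof (rule ccontr)
      assume n: "\<not> gg_context x y"
      then obtain z where z: "z \<in> set F'" using red(4) by (cases F') auto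
      from tight_gap(2)[OF assms(1,2) red(3)[OF z] n] assms(4)[OF that(1)] have "p = fst z" by blast
      with z that(2) show False by blast
    qed
    from canonical_fits[OF assms(1,2) this, of p] assms(4)[OF that(1)]
    obtain f where "canonical x y p = Some f" "fits x y (p, f)" by blast
    moreover have "map_of F' p = None" using that(2) by (simp add: map_of_eq_None_iff)
    ultimately show ?thesis by (simp add: col_def)
  qed
  have tF: "tame ?F"
  proof -
    have "sorted_wrt (\<lambda>p q. q \<le> p) (rev (sorted_list_of_multiset (N + mset (map fst F'))))"
      by (simp add: sorted_wrt_rev)
    then show ?thesis unfolding map_F sorted_wrt_map
      by (rule sorted_wrt_mono_rel[rotated]) auto
  qed
  have "segment x y ?F"
    unfolding segment_def
  proof (intro conjI ballI impI)
    show "fits x y z" if zF: "z \<in> set ?F" for z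
    proof -
      obtain p where p: "z = (p, col p)" "p \<in># N \<or> p \<in> fst ` set F'" using zF unfolding set_F by blast
      show ?thesis
      proof (cases "p \<in> fst ` set F'")
        case True
        then obtain f where "(p, f) \<in> set F'" by auto
        then show ?thesis using F' p red(3) by auto
      next
        case False
        then show ?thesis using new[of p] p by auto
      qed
    qed
    show "gg_context x y" if "?F = []"
    proof -
      have "set ?F = {}" using that by simp
      then have "F' = []" by (simp add: set_F)
      then show ?thesis by (rule red(4))
    qed
  qed (fact tF)
  moreover have "F' = reduce x y ?F"
  proof (rule tame_unique)
    show "tame (reduce x y ?F)" using tF by (simp add: reduce_def sorted_wrt_filter tame_remdups)
    show "distinct (reduce x y ?F)" by (simp add: reduce_def)
    show "set F' = set (reduce x y ?F)"
    proof (intro equalityI subsetI)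
      fix z assume z: "z \<in> set F'"
      then have "z = (fst z, col (fst z))" using F'[of "fst z" "snd z"] by simp
      then have "z \<in> set ?F" using z unfolding set_F by blast
      then show "z \<in> set (reduce x y ?F)" using red(5)[OF z] by (simp add: reduce_def)
    next
      fix z assume z: "z \<in> set (reduce x y ?F)"
      then have "z \<in> set ?F" and c: "canonical x y (fst z) \<noteq> Some (snd z)" by (auto simp: reduce_def)
      then obtain p where p: "z = (p, col p)" "p \<in># N \<or> p \<in> fst ` set F'" unfolding set_F by blast
      have "p \<in> fst ` set F'"
      proof (rule ccontr)
        assume "p \<notin> fst ` set F'"
        then show False using new[of p] p c by auto
      qed
      then obtain f where "(p, f) \<in> set F'" by auto
      then show "z \<in> set F'" using F' p by auto
    qed
  qed (fact red)+
  moreover have "mset (map fst ?F) = N + mset (map fst F')"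
    by (simp add: map_F comp_def)
  ultimately show ?thesis by (simp add: split_segment_def)
qed

text \<open>
  Being reduced is tested here against the immediate neighbours, as the forbidden patterns do. This
  agrees with the test against the enclosing non-free parts, since replacing the latter by a free
  neighbour of another size does not change the canonical colour.
\<close>

fun locally_reduced :: "'c context_part \<Rightarrow> 'c coloured_int list \<Rightarrow> bool" where
  "locally_reduced x (z # w # L) \<longleftrightarrow>
     (snd z \<in> Cfree \<longrightarrow> x \<noteq> Some z \<and> canonical x w (fst z) \<noteq> Some (snd z)) \<and>
     locally_reduced (Some z) (w # L)"
| "locally_reduced x L \<longleftrightarrow> True"

lemma locally_reduced_nonfree:
  "snd y \<notin> Cfree \<Longrightarrow> locally_reduced x (y # T) \<longleftrightarrow> locally_reduced (Some y) T"
  by (cases T) auto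

text \<open>The left end affects the colour only if it is sup of size \<open>p\<close> or inf of
  size \<open>p + 1\<close>. Since \<open>z\<close> is larger than \<open>p\<close>,
  \<open>x\<close> is too large for either, and \<open>z\<close> itself is free.\<close>

lemma canonical_left_free:
  assumes "case x of None \<Rightarrow> True | Some a \<Rightarrow> snd a \<in> C" "snd z \<in> Cfree" "gg_context x z" "p < fst z"
  shows "canonical (Some z) y p = canonical x y p"
proof (cases x)
  case (Some a)
  have "1 \<le> \<epsilon> (snd a) (snd z)" if "snd a \<in> Cinf" using eps_inf_free[OF that assms(2)] by simp
  then show ?thesis using assms Some colours_disjoint[of "snd z"] by (auto simp: canonical_def gg_context_def gg_def Let_def)
qed (use assms colours_disjoint[of "snd z"] in \<open>auto simp: canonical_def Let_def\<close>)

text \<open>The right end affects the colour only if it is inf of size \<open>p\<close> or sup of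
  size \<open>p - 1\<close>. Coming after the smaller part \<open>w\<close>, \<open>y\<close> is too
  small for either, and \<open>w\<close> is free.\<close>

lemma canonical_right_free:
  assumes "right_end y" "snd w \<in> Cfree" "gg \<epsilon> w y" "fst w < p"
  shows "canonical x w p = canonical x y p"
proof -
  have "1 \<le> \<epsilon> (snd w) (snd y)" if "snd y \<in> Csup" using eps_free_sup[OF assms(2) that] by simp
  then show ?thesis using assms colours_disjoint[of "snd w"]
    by (auto simp: canonical_def gg_def Let_def)
qed

lemma locally_reduced_segment:
  assumes "case x of None \<Rightarrow> True | Some a \<Rightarrow> snd a \<in> C" "right_end y" "segment x y F"
  shows "locally_reduced x (F @ y # T) \<longleftrightarrow>
    locally_reduced (Some y) T \<and> distinct F \<and>
    (\<forall>z\<in>set F. x \<noteq> Some z \<and> canonical x y (fst z) \<noteq> Some (snd z))"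
  using assms(1,3)
proof (induction F arbitrary: x)
  case Nil
  have "snd y \<notin> Cfree" using assms(2) colours_disjoint[of "snd y"] by (auto simp: right_end_def)
  then show ?case by (simp add: locally_reduced_nonfree)
next
  case (Cons z F)
  have zf: "snd z \<in> Cfree" using Cons.prems(2) segment_free by auto
  have yC: "snd y \<in> C \<union> {cinfty}" using assms(2) by (auto simp: right_end_def)
  have xz: "gg_context x z" and seg: "segment (Some z) y F"
    using segment_Cons[OF Cons.prems(1) zf yC] Cons.prems(2) by auto
  obtain w L where w: "F @ y # T = w # L" by (cases F) auto
  have IH: "locally_reduced (Some z) (F @ y # T) \<longleftrightarrow> locally_reduced (Some y) T \<and> distinct F \<and>
    (\<forall>z'\<in>set F. Some z \<noteq> Some z' \<and> canonical (Some z) y (fst z') \<noteq> Some (snd z'))"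
    using Cons.IH[of "Some z"] seg zf by simp
  show ?case
  \<comment> \<open>A recurrence of \<open>z\<close> falsifies both sides. Otherwise all sizes in
    \<open>F\<close> are smaller than that of \<open>z\<close>, and the two preceding lemmas trade
    neighbours for ends.\<close>
  proof (cases "z \<in> set F")
    case True
    then show ?thesis using IH w by auto
  next
    case False
    have lt: "fst z' < fst z" if "z' \<in> set F" for z'
      using that False Cons.prems(2) by (auto simp: segment_def)
    have l: "canonical (Some z) y (fst z') = canonical x y (fst z')" if "z' \<in> set F" for z'
      using canonical_left_free[OF Cons.prems(1) zf xz lt[OF that]] .
    have r: "canonical x w (fst z) = canonical x y (fst z)"
    proof (cases F)
      case (Cons w' F')
      then have "w = w'" "w' \<in> set F" using w by auto
      then show ?thesis
        using canonical_right_free[OF assms(2), of w "fst z"] seg lt[of w] segment_free[OF seg]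
        by (auto simp: segment_def fits_def)
    qed (use w in simp)
    have n: "x \<noteq> Some z'" if "z' \<in> set F" for z'
      using xz lt[OF that] by (auto simp: gg_context_def gg_def)
    show ?thesis using IH w l r n False zf by auto
  qed
qed

subsection \<open>Gluing the segments\<close>

text \<open>Graph of the bijection: non-free parts stay in place, each segment is reduced, and the
  removed sizes are collected. As a relation it can be studied from either side.\<close>

inductive splits :: "'c context_part \<Rightarrow> 'c coloured_int list \<Rightarrow> 'c coloured_int list \<Rightarrow> int multiset \<Rightarrow> bool" where
  splits_ground: "split_segment x ground F F' N \<Longrightarrow> splits x (F @ [ground]) (F' @ [ground]) N"
| splits_part: "split_segment x y F F' N \<Longrightarrow> snd y \<in> Csup \<union> Cinf \<Longrightarrow> splits (Some y) T T' N' \<Longrightarrow>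
    splits x (F @ y # T) (F' @ y # T') (N + N')"

lemma splits_total_left:
  assumes "valid x L"
  shows "\<exists>M N. splits x L M N"
  using assms
proof induction
  case (valid_ground x F)
  then show ?case using split_segment_total splits_ground by blast
next
  case (valid_part x y F T)
  then show ?case using split_segment_total splits_part by blast
qed

lemma reduced_iff:
  assumes "left_end x" "right_end y" "segment x y F"
  shows "locally_reduced x (F @ y # T) \<longleftrightarrow> reduced x y F \<and> locally_reduced (Some y) T"
proof -
  have "x \<noteq> Some z" if "z \<in> set F" for z
    using segment_free[OF assms(3) that] assms(1) colours_disjoint[of "snd z"] by (auto simp: left_end_def)
  then show ?thesis
    using locally_reduced_segment[OF left_end_C[OF assms(1)] assms(2,3), of T] assms(3)
    by (auto simp: reduced_def)
qed

text \<open>Surjectivity. The sizes of \<open>N\<close> that are \<open>above y\<close> go to the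
  first segment; the others are \<open>below\<close> the context \<open>Some y\<close> and are
  passed on to the tail. The ground part accepts every positive size.\<close>

lemma splits_total_right:
  assumes "valid x M" "left_end x" "locally_reduced x M" "\<And>p. p \<in># N \<Longrightarrow> below x p \<and> 0 < p"
  shows "\<exists>L. splits x L M N"
  using assms
proof (induction arbitrary: N)
  case (valid_ground x F)
  have "reduced x ground F" using reduced_iff[of x ground F "[]"] valid_ground by simp
  then have "split_segment x ground (expand x ground F N) F N"
    using split_expand[of x ground F N] valid_ground by simp
  then show ?case using splits_ground by blast
next
  case (valid_part x y F T)
  have y: "right_end y" "left_end (Some y)" using nonfree_ends[OF valid_part(2)] by auto
  have red: "reduced x y F" "locally_reduced (Some y) T" using reduced_iff[of x y F T] valid_part y by auto
  let ?N = "filter_mset (above y) N" and ?N' = "filter_mset (\<lambda>p. \<not> above y p) N"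
  have "split_segment x y (expand x y F ?N) F ?N"
    using split_expand[of x y F ?N] valid_part y red by simp
  moreover obtain L where "splits (Some y) L T ?N'"
    using valid_part.IH[of ?N'] y red valid_part.prems(3) by (auto simp: below_def)
  ultimately have "splits x (expand x y F ?N @ y # L) (F @ y # T) (?N + ?N')"
    using splits_part valid_part(2) by blast
  then show ?case by (metis multiset_partition)
qed

lemma split_segment_reduced:
  assumes "left_end x" "right_end y" "split_segment x y F F' N"
  shows "reduced x y F'" "segment x y F" "segment x y F'"
proof -
  show S: "segment x y F" using assms(3) by (simp add: split_segment_def)
  show R: "reduced x y F'"
    using reduce_reduced[OF assms(1,2) S] assms(3) by (simp add: split_segment_def)
  show "segment x y F'" using R by (simp add: reduced_def)
qed

lemma splits_valid:
  assumes "splits x L M N" "left_end x"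
  shows "valid x L \<and> valid x M \<and> locally_reduced x M \<and> (\<forall>p. p \<in># N \<longrightarrow> below x p \<and> 0 < p)"
  using assms
proof induction
  case (splits_ground x F F' N)
  note S = split_segment_reduced[OF splits_ground.prems right_end_ground splits_ground.hyps]
  show ?case
    using S splits_ground reduced_iff[OF splits_ground.prems right_end_ground S(3), of "[]"]
      split_segment_range[OF splits_ground.prems right_end_ground splits_ground.hyps]
    by (auto intro: valid_ground)
next
  case (splits_part x y F F' N T T' N')
  have y: "right_end y" "left_end (Some y)" using nonfree_ends[OF splits_part(2)] by auto
  note S = split_segment_reduced[OF splits_part.prems y(1) splits_part.hyps(1)]
  note IH = splits_part.IH[OF y(2)]
  have "below x p" if "below (Some y) p" for p
  proof (cases x)
    case (Some a)
    then show ?thesis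
      using segment_above_mono[of a y F p] splits_part.prems y S(2) that by (auto simp: below_def)
  qed (simp add: below_def)
  moreover have "0 < p" if "above y p" for p
    using valid_positive[of "Some y" T] IH y that by blast
  ultimately show ?case
    using S IH splits_part(2) reduced_iff[OF splits_part.prems y(1) S(3), of T']
      split_segment_range[OF splits_part.prems y(1) splits_part.hyps(1)]
    by (auto intro: valid_part)
qed

lemma split_segment_free:
  assumes "split_segment x y F F' N"
  shows "\<forall>z\<in>set F. snd z \<in> Cfree" "\<forall>z\<in>set F'. snd z \<in> Cfree"
  using assms segment_free[of x y F] by (simp_all add: split_segment_def reduce_def)

lemma colour_product_append: "colour_product D (xs @ ys) = colour_product D xs + colour_product D ys"
  by (simp add: colour_product_def)

lemma colour_product_Cons:
  "colour_product D (x # xs) = (if snd x \<in> D then {#snd x#} else {#}) + colour_product D xs"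
  by (simp add: colour_product_def)

lemma splits_weights:
  assumes "splits x L M N"
  shows "total_size L = total_size M + sum_mset N \<and> length L = length M + size N \<and>
    colour_product (Csup \<union> Cinf) L = colour_product (Csup \<union> Cinf) M"
  using assms
proof induction
  have seg: "sum_list (map fst F) = sum_list (map fst F') + sum_mset N \<and> length F = length F' + size N \<and>
      colour_product (Csup \<union> Cinf) F = {#} \<and> colour_product (Csup \<union> Cinf) F' = {#}"
    if S: "split_segment x y F F' N" for x y F F' N
  proof (intro conjI)
    have E: "mset (map fst F) = N + mset (map fst F')" using S by (simp add: split_segment_def)
    have "sum_mset (mset (map fst F)) = sum_mset (N + mset (map fst F'))" by (simp only: E)
    then show "sum_list (map fst F) = sum_list (map fst F') + sum_mset N"
      by (simp only: sum_mset_sum_list sum_mset.union)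
    have "size (mset (map fst F)) = size (N + mset (map fst F'))" by (simp only: E)
    then show "length F = length F' + size N" by simp
  qed (use split_segment_free[OF S] colours_disjoint in \<open>fastforce simp: colour_product_def\<close>)+
  {
    case (splits_ground x F F' N)
    then show ?case using seg[OF splits_ground] by (simp add: total_size_def colour_product_append)
  next
    case (splits_part x y F F' N T T' N')
    then show ?case using seg[OF splits_part(1)]
      by (simp add: total_size_def colour_product_append colour_product_Cons)
  }
qed

lemma first_nonfree_unique:
  assumes "F @ y # T = G @ w # U" "\<forall>z\<in>set F. snd z \<in> Cfree" "\<forall>z\<in>set G. snd z \<in> Cfree"
    "snd y \<notin> Cfree" "snd w \<notin> Cfree"
  shows "F = G \<and> y = w \<and> T = U"
  using assms
proof (induction F arbitrary: G)
  case Nil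
  then show ?case by (cases G) auto
next
  case (Cons a F)
  then show ?case by (cases G) auto
qed

lemma nonfree: "snd y \<in> Csup \<union> Cinf \<Longrightarrow> snd y \<notin> Cfree \<and> y \<noteq> ground"
  using colours_disjoint[of "snd y"] by auto

lemma splits_functional: "splits x L M N \<Longrightarrow> splits x L M' N' \<Longrightarrow> M = M' \<and> N = N'"
proof (induction arbitrary: M' N' rule: splits.induct)
  case (splits_ground x F F' N)
  from splits_ground.prems show ?case
  proof cases
    case (splits_ground G)
    then show ?thesis using splits_ground \<open>split_segment x ground F F' N\<close> by (auto simp: split_segment_def)
  next
    case (splits_part y G G' K T T' K')
    then show ?thesis
      using first_nonfree_unique[of F ground "[]" G y T] split_segment_free(1) \<open>split_segment x ground F F' N\<close>
        nonfree[of y] by auto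
  qed
next
  case (splits_part x y F F' N T T' K)
  note S = splits_part
  from splits_part.prems show ?case
  proof cases
    case (splits_ground G)
    then show ?thesis
      using first_nonfree_unique[of F y T G ground "[]"] split_segment_free(1) S(1) nonfree[OF S(2)] by auto
  next
    case (splits_part w G G' N2 U U' K2)
    then have "F = G \<and> y = w \<and> T = U"
      using first_nonfree_unique[of F y T G w U] split_segment_free(1) S(1) nonfree[OF S(2)] nonfree[of w] by auto
    then show ?thesis using splits_part S by (auto simp: split_segment_def)
  qed
qed

text \<open>The total multiset can be separated again: sizes removed from the first segment are all
  \<open>above y\<close>, and those removed later never are. Each segment is then recovered by
  \<open>expand\<close>.\<close>

lemma splits_injective: "splits x L M N \<Longrightarrow> splits x L' M N \<Longrightarrow> left_end x \<Longrightarrow> L = L'"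
proof (induction arbitrary: L' rule: splits.induct)
  case (splits_ground x F F' N)
  from splits_ground.prems(1) show ?case
  proof cases
    case (splits_ground G)
    then show ?thesis
      using splits_ground \<open>split_segment x ground F F' N\<close> expand_split by blast
  next
    case (splits_part y G G' K T T' K')
    then show ?thesis
      using first_nonfree_unique[of F' ground "[]" G' y T'] split_segment_free(2) \<open>split_segment x ground F F' N\<close>
        nonfree[of y] by auto
  qed
next
  case (splits_part x y F F' N T T' K)
  note S = splits_part
  have y: "right_end y" "left_end (Some y)" using nonfree_ends[OF S(2)] by auto
  from splits_part.prems(1) show ?case
  proof cases
    case (splits_ground G G')
    then show ?thesis
      using first_nonfree_unique[of F' y T' G' ground "[]"] split_segment_free(2) S(1) nonfree[OF S(2)] by auto
  next
    case (splits_part w G G' N2 U U' K2)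
    then have e: "F' = G'" "y = w" "T' = U'"
      using first_nonfree_unique[of F' y T' G' w U'] split_segment_free(2) S(1) nonfree[OF S(2)] nonfree[of w] by auto
    have "filter_mset (above y) N = N" "filter_mset (above y) N2 = N2"
      using split_segment_range(2)[OF S(6) y(1)] S(1) splits_part e by (auto simp: filter_mset_eq_conv)
    moreover have "filter_mset (above y) K = {#}" "filter_mset (above y) K2 = {#}"
      using splits_valid[OF S(3) y(2)] splits_valid[of "Some y" U U' K2] splits_part e y(2)
      by (auto simp: filter_mset_eq_mempty_iff below_def)
    ultimately have "N = N2"
      using \<open>N + K = N2 + K2\<close> by (metis add.right_neutral filter_union_mset)
    then have "K = K2" using \<open>N + K = N2 + K2\<close> by simp
    then have "T = U" using S(4)[of U] splits_part e y(2) by simp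
    moreover have "F = G" using \<open>N = N2\<close> e S(1) splits_part expand_split by blast
    ultimately show ?thesis using e splits_part by simp
  qed
qed

subsection \<open>Forbidden patterns\<close>

abbreviation "forb \<equiv> forbidden_patterns Csup Cfree Cinf cinfty c0 \<epsilon> \<delta> \<gamma>"

lemma forb_pair: "[a, z] \<in> forb \<longleftrightarrow> a = z \<and> snd z \<in> Cfree - {c0} \<and> 0 \<le> fst z"
  by (cases a; cases z) (auto elim: forbidden_patterns.cases intro: forbidden_patterns.intros)

lemma forb_length: "ys \<in> forb \<Longrightarrow> (\<exists>a z. ys = [a, z]) \<or> (\<exists>a z w. ys = [a, z, w])"
  by (auto elim: forbidden_patterns.cases)

lemma forb_triple_free: "[a, z, w] \<in> forb \<Longrightarrow> snd z \<in> Cfree"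
proof (erule forbidden_patterns.cases)
qed (use delta_sup delta_inf gamma_eps_sup_inf gamma_eps_sup_sup gamma_eps_inf_inf in \<open>auto simp: le_Suc_eq\<close>)

lemma canonical_if_forb:
  assumes "[a, z, w] \<in> forb"
  shows "canonical (Some a) w (fst z) = Some (snd z)"
  using assms
proof cases
  case (gamma_sup_inf p c c')
  then show ?thesis by (simp add: canonical_def)
next
  case (gamma_sup_sup p c c')
  then show ?thesis by (auto simp: canonical_def)
next
  case (gamma_inf_inf p c c')
  then show ?thesis by (auto simp: canonical_def)
next
  case (delta_sup_1 p c c')
  then show ?thesis using colours_disjoint[of c'] by (auto simp: canonical_def)
next
  case (delta_sup_2 p c c' u)
  then show ?thesis by (auto simp: canonical_def)
next
  case (delta_inf_1 p c' c)
  then show ?thesis using colours_disjoint[of c] by (auto simp: canonical_def)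
next
  case (delta_inf_2 p c' c u)
  then show ?thesis by (auto simp: canonical_def)
qed

text \<open>The branches of \<open>canonical\<close> match the forbidden triples one by one. The
  default branch has no pattern, but it would give \<open>z\<close> the colour
  \<open>c0\<close>.\<close>

lemma forb_if_canonical:
  assumes a: "snd a \<in> C - {c0}" and w: "snd w \<in> (C - {c0}) \<union> {cinfty}"
    and z: "snd z \<in> Cfree - {c0}" "0 \<le> fst z"
    and gg: "gg \<epsilon> a z" "gg \<epsilon> z w" and ne: "a \<noteq> z" "z \<noteq> w"
    and can: "canonical (Some a) w (fst z) = Some (snd z)"
  shows "[a, z, w] \<in> forb"
proof -
  obtain q c p f r d where e: "a = (q, c)" "z = (p, f)" "w = (r, d)" by (cases a; cases z; cases w) auto
  have f: "f \<in> Cfree" "f \<noteq> c0" "0 \<le> p" using z e by auto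
  \<comment> \<open>As \<open>z\<close> is free and differs from its neighbours, equal sizes occur
    only next to an inf part on the right or a sup part on the left.\<close>
  have ww: "r < p \<or> r = p \<and> d \<in> Cinf"
    using gg(2) w ne(2) e eps_free_free[OF f(1), of d] eps_free_sup[OF f(1), of d] eps_free_infty[OF f(1)]
    by (auto simp: gg_def split: if_splits)
  have aa: "p < q \<or> q = p \<and> c \<in> Csup"
    using gg(1) a ne(1) e eps_free_free[of c f] eps_inf_free[of c f] f
    by (auto simp: gg_def split: if_splits)
  have A: "p < q \<Longrightarrow> q = p + 1 \<or> q \<ge> p + 2" and B: "r < p \<Longrightarrow> r = p - 1 \<or> r \<le> p - 2" by linarith+
  consider (sup_inf) "q = p" "c \<in> Csup" "r = p" "d \<in> Cinf" | (sup_sup) "q = p" "c \<in> Csup" "r = p - 1" "d \<in> Csup"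
    | (sup1) "q = p" "c \<in> Csup" "r = p - 1" "d \<notin> Csup"
    | (sup2) "q = p" "c \<in> Csup" "r \<le> p - 2"
    | (inf_inf) "q = p + 1" "c \<in> Cinf" "r = p" "d \<in> Cinf"
    | (inf1) "q = p + 1" "c \<notin> Cinf" "r = p" "d \<in> Cinf"
    | (inf2) "q \<ge> p + 2" "r = p" "d \<in> Cinf"
    | (none) "q > p" "r < p"
    using aa ww A B by blast
  then show ?thesis
  proof cases
    case sup_inf
    then have "f = \<gamma> c d" "\<epsilon> c d = 0" using can e by (auto simp: canonical_def split: if_splits)
    then show ?thesis
      unfolding e using forbidden_patterns.gamma_sup_inf f(3) sup_inf by metis
  next
    case sup_sup
    then have "f = \<gamma> c d" "\<epsilon> c d \<in> {0, 1}"
      using can e colours_disjoint[of d] by (auto simp: canonical_def le_Suc_eq split: if_splits)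
    then show ?thesis
      unfolding e using forbidden_patterns.gamma_sup_sup f(3) sup_sup by metis
  next
    case sup1
    then have "f = \<delta> c" using can e by (simp add: canonical_def)
    moreover have "d \<in> (Cfree - {c0}) \<union> Cinf \<union> {cinfty}" using sup1 w e by auto
    ultimately show ?thesis
      unfolding e using forbidden_patterns.delta_sup_1 f(3) sup1 by metis
  next
    case sup2
    then have "f = \<delta> c" using can e by (simp add: canonical_def)
    \<comment> \<open>The pattern is instantiated with \<open>u = p - r\<close>.\<close>
    moreover have "[(p, c), (p, \<delta> c), (p - (p - r), d)] \<in> forb"
      by (rule forbidden_patterns.delta_sup_2) (use f sup2 w e in auto)
    ultimately show ?thesis using e sup2 by simp
  next
    case inf_inf
    then have "f = \<gamma> c d" "\<epsilon> c d \<in> {0, 1}"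
      using can e colours_disjoint[of c] by (auto simp: canonical_def le_Suc_eq split: if_splits)
    then show ?thesis
      unfolding e using forbidden_patterns.gamma_inf_inf f(3) inf_inf by metis
  next
    case inf1
    then have "f = \<delta> d" using can e by (simp add: canonical_def)
    moreover have "c \<in> (Cfree - {c0}) \<union> Csup" using inf1 a e by auto
    ultimately show ?thesis
      unfolding e using forbidden_patterns.delta_inf_1 f(3) inf1 by metis
  next
    case inf2
    then have "f = \<delta> d" using can e by (simp add: canonical_def)
    moreover have "[(p + (q - p), c), (p, \<delta> d), (p, d)] \<in> forb"
      by (rule forbidden_patterns.delta_inf_2) (use f inf2 a e in auto)
    ultimately show ?thesis using e inf2 by simp
  next
    case none
    then have "f = c0" using can e by (simp add: canonical_def)
    then show ?thesis using f by simp
  qed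
qed

text \<open>Having \<epsilon> equal to 1 with all other colours, \<open>c0\<close> forces a strict
  descent on both sides, so the default branch applies. Hence a locally reduced list contains no
  \<open>c0\<close>.\<close>

lemma canonical_c0:
  assumes "case x of None \<Rightarrow> True | Some a \<Rightarrow> snd a \<in> C - {c0}" "snd z = c0" "gg_context x z" "gg \<epsilon> z w"
  shows "canonical x w (fst z) = Some c0"
proof -
  have "\<not> (fst w = fst z \<and> snd w \<in> Cinf)" using assms(2,4) c0_right[of "snd w"] by (auto simp: gg_def)
  moreover have "\<not> (x \<noteq> None \<and> fst (the x) = fst z \<and> snd (the x) \<in> Csup)"
    using assms(1-3) c0_left[of "snd (the x)"] by (auto simp: gg_def gg_context_def)
  ultimately show ?thesis by (auto simp: canonical_def Let_def)
qed

text \<open>Induction on the list with the preceding part kept as \<open>x\<close>, so that each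
  step tests only the patterns starting at \<open>x\<close>. The pattern tied to the start of the
  sequence is the case \<open>x = None\<close>.\<close>

lemma locally_reduced_iff_no_pattern:
  assumes "case x of None \<Rightarrow> True | Some a \<Rightarrow> snd a \<in> C - {c0}" "\<forall>z\<in>set xs. snd z \<in> C"
    "chain x (xs @ [ground])" "\<forall>z\<in>set xs. snd z \<in> Cfree \<longrightarrow> 0 < fst z"
  shows "locally_reduced x (xs @ [ground]) \<longleftrightarrow>
    (\<forall>ys\<in>forb. \<not> sublist ys ((case x of None \<Rightarrow> [] | Some a \<Rightarrow> [a]) @ xs @ [ground])) \<and>
    (\<forall>z\<in>set xs. snd z \<noteq> c0) \<and>
    (x = None \<longrightarrow> (\<forall>p\<ge>0. \<forall>c'\<in>Cinf. \<not> prefix [(p, \<delta> c'), (p, c')] (xs @ [ground])))"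
  using assms
proof (induction xs arbitrary: x)
  case Nil
  have "\<not> sublist ys ((case x of None \<Rightarrow> [] | Some a \<Rightarrow> [a]) @ [ground])" if "ys \<in> forb" for ys
  proof
    assume s: "sublist ys ((case x of None \<Rightarrow> [] | Some a \<Rightarrow> [a]) @ [ground])"
    from sublist_length_le[OF s] forb_length[OF that] s that show False
      by (auto simp: sublist_Cons_right forb_pair split: option.splits)
  qed
  then show ?case by auto
next
  case (Cons z xs)
  obtain w L where w: "xs @ [ground] = w # L" by (cases xs) auto
  have zC: "snd z \<in> C" and ch: "gg_context x z" "chain (Some z) (xs @ [ground])" and zw: "gg \<epsilon> z w"
    using Cons.prems(2,3) w by (auto simp: chain_Cons gg_context_def)
  have lr: "locally_reduced x ((z # xs) @ [ground]) \<longleftrightarrow>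
     (snd z \<in> Cfree \<longrightarrow> x \<noteq> Some z \<and> canonical x w (fst z) \<noteq> Some (snd z)) \<and>
     locally_reduced (Some z) (xs @ [ground])" using w by simp
  show ?case
  proof (cases "snd z = c0")
    case True
    then show ?thesis using lr canonical_c0[OF Cons.prems(1) True ch(1) zw] c0_free by auto
  next
    case False
    have IH: "locally_reduced (Some z) (xs @ [ground]) \<longleftrightarrow>
      (\<forall>ys\<in>forb. \<not> sublist ys (z # xs @ [ground])) \<and> (\<forall>z\<in>set xs. snd z \<noteq> c0)"
      using Cons.IH[of "Some z"] Cons.prems zC False ch by auto
    show ?thesis
    proof (cases "(\<forall>ys\<in>forb. \<not> sublist ys (z # xs @ [ground])) \<and> (\<forall>z\<in>set xs. snd z \<noteq> c0)")
      case no: False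
      \<comment> \<open>A violation in the tail persists when parts are put in front, so both sides
        are false.\<close>
      have "\<not> locally_reduced x ((z # xs) @ [ground])" using no IH lr by blast
      moreover have "sublist ys ((case x of None \<Rightarrow> [] | Some a \<Rightarrow> [a]) @ (z # xs) @ [ground])"
        if "sublist ys (z # xs @ [ground])" for ys
        using that by (auto simp: sublist_Cons_right split: option.splits)
      ultimately show ?thesis using no by auto
    next
      case yes: True
      have "w \<in> set (xs @ [ground])" using w by simp
      then have wC: "snd w \<in> (C - {c0}) \<union> {cinfty}" using yes Cons.prems(2) by auto
      have "sublist [z, w] (z # xs @ [ground])" using w by (simp add: sublist_Cons_right)
      then have "[z, w] \<notin> forb" using yes by blast
      then have zne: "z \<noteq> w" if "snd z \<in> Cfree"
        using that False Cons.prems(4) by (fastforce simp: forb_pair)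
      show ?thesis
      proof (cases x)
        case None
        \<comment> \<open>Without a left neighbour the canonical colour is \<open>\<delta>\<close>
          of an inf part of equal size on the right, or else \<open>c0\<close>, which is excluded
          here.\<close>
        have "snd z \<in> Cfree \<longrightarrow> canonical x w (fst z) \<noteq> Some (snd z) \<longleftrightarrow>
            (\<forall>p\<ge>0. \<forall>c'\<in>Cinf. \<not> (z = (p, \<delta> c') \<and> w = (p, c')))" if "snd z \<in> Cfree"
          using None False that Cons.prems(4) by (cases z; cases w) (auto simp: canonical_def Let_def split: if_splits)
        moreover have "\<not> (z = (p, \<delta> c') \<and> w = (p, c'))" if "snd z \<notin> Cfree" "c' \<in> Cinf" for p c'
          using that delta_inf by auto
        ultimately have "(snd z \<in> Cfree \<longrightarrow> canonical x w (fst z) \<noteq> Some (snd z)) \<longleftrightarrow>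
            (\<forall>p\<ge>0. \<forall>c'\<in>Cinf. \<not> (z = (p, \<delta> c') \<and> w = (p, c')))" by blast
        then show ?thesis using lr IH yes None False w by auto
      next
        case (Some a)
        have aC: "snd a \<in> C - {c0}" and az: "gg \<epsilon> a z" using Cons.prems(1) Some ch by (auto simp: gg_context_def)
        \<comment> \<open>Patterns have two or three parts and the tail is free of them, so only the
          two starting at \<open>a\<close> remain.\<close>
        have "(\<forall>ys\<in>forb. \<not> sublist ys (a # z # w # L)) \<longleftrightarrow> [a, z] \<notin> forb \<and> [a, z, w] \<notin> forb"
        proof
          assume "\<forall>ys\<in>forb. \<not> sublist ys (a # z # w # L)"
          then show "[a, z] \<notin> forb \<and> [a, z, w] \<notin> forb" by (auto simp: sublist_Cons_right)
        next
          assume "[a, z] \<notin> forb \<and> [a, z, w] \<notin> forb"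
          then have "\<not> prefix ys (a # z # w # L)" if "ys \<in> forb" for ys
            using forb_length[OF that] that by auto
          then show "\<forall>ys\<in>forb. \<not> sublist ys (a # z # w # L)"
            using yes w by (metis sublist_Cons_right)
        qed
        also have "\<dots> \<longleftrightarrow> (snd z \<in> Cfree \<longrightarrow> x \<noteq> Some z \<and> canonical x w (fst z) \<noteq> Some (snd z))"
        proof (cases "snd z \<in> Cfree")
          case zf: True
          have pos: "0 \<le> fst z" using zf Cons.prems(4) by force
          show ?thesis
            using forb_if_canonical[OF aC wC _ pos az zw _ zne[OF zf]] canonical_if_forb[of a z w]
              forb_pair[of a z] zf False pos Some by auto
        next
          case zf: False
          then show ?thesis using forb_pair[of a z] forb_triple_free[of a z w] by auto
        qed
        finally show ?thesis using lr IH yes Some False w by simp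
      qed
    qed
  qed
qed

lemma restricted_iff:
  "L \<in> restricted_partitions Csup Cfree Cinf cinfty c0 \<epsilon> \<delta> \<gamma> \<longleftrightarrow> valid None L \<and> locally_reduced None L"
proof (cases "valid None L")
  case True
  have le: "left_end None" by (simp add: left_end_def)
  obtain xs where xs: "L = xs @ [ground]" "\<forall>z\<in>set xs. snd z \<in> C" "chain None L"
    using chain_if_valid[OF True le] by auto
  have "cinfty \<noteq> c0" using c0_free infty_not_colour by metis
  then show ?thesis
    using locally_reduced_iff_no_pattern[of None xs] xs valid_positive[OF True le] True grounded_iff_valid[of L]
    by (auto simp: restricted_partitions_def)
qed (simp add: restricted_partitions_def grounded_iff_valid)

section \<open>Integer partitions as multisets, and the final bijection\<close>

abbreviation parts_list :: "int multiset \<Rightarrow> int list" where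
  "parts_list N \<equiv> rev (sorted_list_of_multiset N)"

lemma parts_list_mem: "parts_list N \<in> integer_partitions \<longleftrightarrow> (\<forall>p\<in>#N. 0 < p)"
  by (simp add: integer_partitions_def sorted_wrt_rev)

lemma parts_list_mset:
  assumes "ks \<in> integer_partitions"
  shows "parts_list (mset ks) = ks"
proof -
  have "sorted (rev ks)" using assms by (simp add: integer_partitions_def sorted_wrt_rev)
  then have "sorted_list_of_multiset (mset (rev ks)) = rev ks"
    by (simp only: sorted_list_of_multiset_mset sorted_sort_id)
  then show ?thesis by simp
qed

lemma bijection:
  "\<exists>\<Phi> :: 'c coloured_int list \<Rightarrow> 'c coloured_int list \<times> int list.
    bij_betw \<Phi> (grounded_partitions C cinfty \<epsilon>)
      (restricted_partitions Csup Cfree Cinf cinfty c0 \<epsilon> \<delta> \<gamma> \<times> integer_partitions) \<and>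
    (\<forall>xs\<in>grounded_partitions C cinfty \<epsilon>. \<forall>\<mu> \<nu>. \<Phi> xs = (\<mu>, \<nu>) \<longrightarrow>
       total_size xs = total_size \<mu> + sum_list \<nu> \<and>
       length xs = length \<mu> + length \<nu> \<and>
       colour_product (Csup \<union> Cinf) xs = colour_product (Csup \<union> Cinf) \<mu>)"
proof -
  have le: "left_end None" by (simp add: left_end_def)
  have "\<forall>L. \<exists>MN. valid None L \<longrightarrow> splits None L (fst MN) (snd MN)"
    using splits_total_left by fastforce
  then obtain \<psi> where \<psi>: "\<And>L. valid None L \<Longrightarrow> splits None L (fst (\<psi> L)) (snd (\<psi> L))" by metis
  define \<Phi> where "\<Phi> L = (fst (\<psi> L), parts_list (snd (\<psi> L)))" for L
  \<comment> \<open>The choice of \<open>\<psi>\<close> is immaterial because \<open>splits\<close>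
    is functional.\<close>
  have \<Phi>: "\<Phi> L = (M, parts_list N)" if "splits None L M N" for L M N
    using that \<psi> splits_functional splits_valid[OF that le] by (fastforce simp: \<Phi>_def)
  have "bij_betw \<Phi> (grounded_partitions C cinfty \<epsilon>)
      (restricted_partitions Csup Cfree Cinf cinfty c0 \<epsilon> \<delta> \<gamma> \<times> integer_partitions)"
    unfolding bij_betw_def
  proof (intro conjI inj_onI equalityI subsetI)
    fix L L' assume "L \<in> grounded_partitions C cinfty \<epsilon>" "L' \<in> grounded_partitions C cinfty \<epsilon>" "\<Phi> L = \<Phi> L'"
    moreover from this(3) have "\<psi> L = \<psi> L'"
      by (auto simp: \<Phi>_def prod_eq_iff) (metis mset_sorted_list_of_multiset)
    ultimately show "L = L'" using \<psi>[of L] \<psi>[of L'] splits_injective le by (auto simp: grounded_iff_valid)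
  next
    fix m assume "m \<in> \<Phi> ` grounded_partitions C cinfty \<epsilon>"
    then obtain L where "m = \<Phi> L" "valid None L" by (auto simp: grounded_iff_valid)
    then show "m \<in> restricted_partitions Csup Cfree Cinf cinfty c0 \<epsilon> \<delta> \<gamma> \<times> integer_partitions"
      using splits_valid[OF \<psi> le, of L] by (simp add: \<Phi>_def restricted_iff parts_list_mem)
  next
    fix m assume m: "m \<in> restricted_partitions Csup Cfree Cinf cinfty c0 \<epsilon> \<delta> \<gamma> \<times> integer_partitions"
    obtain \<mu> \<nu> where mn: "m = (\<mu>, \<nu>)" by (cases m)
    have "\<exists>L. splits None L \<mu> (mset \<nu>)"
      using splits_total_right[of None \<mu> "mset \<nu>"] m mn le
      by (auto simp: restricted_iff below_def integer_partitions_def)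
    then obtain L where L: "splits None L \<mu> (mset \<nu>)" by blast
    then have "\<Phi> L = m" using \<Phi>[OF L] parts_list_mset m mn by simp
    moreover have "L \<in> grounded_partitions C cinfty \<epsilon>" using splits_valid[OF L le] by (simp add: grounded_iff_valid)
    ultimately show "m \<in> \<Phi> ` grounded_partitions C cinfty \<epsilon>" by blast
  qed
  moreover have "total_size xs = total_size \<mu> + sum_list \<nu> \<and> length xs = length \<mu> + length \<nu> \<and>
       colour_product (Csup \<union> Cinf) xs = colour_product (Csup \<union> Cinf) \<mu>"
    if "xs \<in> grounded_partitions C cinfty \<epsilon>" "\<Phi> xs = (\<mu>, \<nu>)" for xs \<mu> \<nu>
  proof -
    have v: "valid None xs" using that(1) by (simp add: grounded_iff_valid)
    have "\<mu> = fst (\<psi> xs)" "\<nu> = parts_list (snd (\<psi> xs))" using that(2) by (auto simp: \<Phi>_def)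
    moreover have "sum_list (parts_list N) = sum_mset N" "length (parts_list N) = size N" for N
      by (metis mset_rev mset_sorted_list_of_multiset sum_mset_sum_list)
        (metis length_rev mset_sorted_list_of_multiset size_mset)
    ultimately show ?thesis using splits_weights[OF \<psi>[OF v]] by simp
  qed
  ultimately show ?thesis by blast
qed

end

theorem theorem3p4:
  fixes Csup Cfree Cinf :: "'c set" and cinfty c0 :: 'c
    and \<epsilon> :: "'c \<Rightarrow> 'c \<Rightarrow> nat" and \<delta> :: "'c \<Rightarrow> 'c" and \<gamma> :: "'c \<Rightarrow> 'c \<Rightarrow> 'c"
  assumes "colour_partition Csup Cfree Cinf cinfty"
    and "well_defined_eps Csup Cfree Cinf cinfty \<epsilon>"
    and "delta_witness Csup Cfree Cinf \<epsilon> \<delta>"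
    and "gamma_witness Csup Cfree Cinf \<epsilon> \<gamma>"
    and "c0 \<in> Cfree"
    and "\<forall>c\<in>(Csup \<union> Cfree \<union> Cinf) - {c0}. \<epsilon> c0 c = 1 \<and> \<epsilon> c c0 = 1"
  shows "\<exists>\<Phi> :: 'c coloured_int list \<Rightarrow> 'c coloured_int list \<times> int list.
    bij_betw \<Phi> (grounded_partitions (Csup \<union> Cfree \<union> Cinf) cinfty \<epsilon>)
      (restricted_partitions Csup Cfree Cinf cinfty c0 \<epsilon> \<delta> \<gamma> \<times> integer_partitions) \<and>
    (\<forall>xs\<in>grounded_partitions (Csup \<union> Cfree \<union> Cinf) cinfty \<epsilon>. \<forall>\<mu> \<nu>. \<Phi> xs = (\<mu>, \<nu>) \<longrightarrow>
       total_size xs = total_size \<mu> + sum_list \<nu> \<and>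
       length xs = length \<mu> + length \<nu> \<and>
       colour_product (Csup \<union> Cinf) xs = colour_product (Csup \<union> Cinf) \<mu>)"
proof -
  interpret coloured_setting Csup Cfree Cinf cinfty c0 \<epsilon> \<delta> \<gamma>
    by unfold_locales (fact assms)+
  show ?thesis by (rule bijection)
qed

end
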